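(* Two agents executing Algorithm PTBoundWithChirality (defined in the context) in the semi-synchronous Passive Transport (PT) model with chirality and a known upper bound $N$ on the size of the ring will explore the (1-interval connected) ring using at most $O(N^2)$ edge traversals. Furthermore, one agent explicitly terminates, while the other either terminates or waits perpetually on a port.
   Context: Ring: the nodes $v_0,\dots,v_{n-1}$ (indices modulo $n$) form a cycle; $v_i$ is linked to $v_{i-1}$ and $v_{i+1}$ via distinctly labelled ports $q_{i-}$ and $q_{i+}$ (labels need not be globally consistent). Time proceeds in rounds; in each round at most one edge, chosen by an adversary, is missing (1-interval connected ring). Nodes are anonymous (no distinguishable identifiers). The agents know $N\ge n$. Agents: each has memory and computational power; they are anonymous (no identifiers) and all execute the same protocol. They start at arbitrary, not necessarily distinct, nodes, cannot communicate explicitly and cannot mark nodes. Each agent $a_j$ has a consistent private orientation, i.e. a function $\lambda_j$ designating each port left or right with $\lambda_j(q_{i-})=\lambda_j(q_{k-})$ for all $i,k$. Chirality: all agents have the same orientation and are aware of it. Round: each active agent performs Look (it sees its own position within its node, i.e. whether it is on a port and which one, and the positions of the other agents at that node), Compute (from this snapshot and its memory it determines a direction in $\{left,right,nil\}$; if $nil$ it becomes inactive; otherwise it tries to access the corresponding port if not already there), and Move. Ports are accessed in mutual exclusion: an occupied port cannot be gained, and if several agents try the same port exactly one succeeds; an agent that fails sets $moved=false$ and becomes inactive. An agent on a port after computing moves to the other endpoint if the edge is present in this round (setting $moved=true$), and otherwise stays on the port (setting $moved=false$); in either case the port is denied to other agents in that round. Two agents crossing the same edge in opposite directions in the same round might not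 detect each other. Semi-synchronous ($\mathcal{SSYNC}$): in each round an adversary activates a non-empty subset of the agents, the others being asleep (passive); every agent is activated infinitely often; an activated agent does not know whether it was active in the previous round. An agent may be asleep on a port. PT model: if an agent is sleeping on a port in round $t$ and the corresponding edge is present in round $t$, the agent is moved to the other endpoint of the edge in round $t$. Exploration is solved if within finite time every node is visited by at least one agent. An agent explicitly terminates if within finite time it enters a terminal state and no longer moves; a terminal state may be entered only after the ring has been explored. The cost is the total number of edge traversals by the agents. Procedure Explore($dir$ | $p_1:s_1$; ...; $p_k:s_k$), with $dir\in\{left,right\}$, predicates $p_i$ and states $s_i$: the agent performs Look, then evaluates $p_1,\dots,p_k$ in order; as soon as some $p_i$ is satisfied the procedure exits and the agent makes a transition to state $s_i$. If no predicate is satisfied, the agent tries to move in direction $dir$ and the procedure is executed again in the next round (in which the agent is active). Variables and predicates of an agent: $Esteps$ is the number of successful moves since Explore was last called (an assignment made on entering a state, before a new call, uses the value of the call just exited); $Tnodes$ is the total number of nodes the agent perceived to have explored since the beginning of the protocol; $Btime$ is the number of consecutive rounds the agent has currently been waiting in a port. "catches": the agent is in the node and the other agent is observed on a port in the moving direction of the first agent. Algorithm PTBoundWithChirality (each agent starts in state Init with $leftSteps\gets\bot$, $rightSteps\gets\bot$; Terminate is the terminal state): - State Init: Explore(left | $Tnodes\ge N$: Terminate; catches: Bounce). - State Bounce: $leftSteps\gets Esteps$; if $rightSteps\ne\bot$ and $rightSteps\ge leftSteps$, Terminate; otherwise Explore(right | $Tnodes\ge N$: Terminate; $Btime>0$: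 Reverse). - State Reverse: $rightSteps\gets Esteps$; Explore(left | $Tnodes\ge N$: Terminate; catches: Bounce). *)

theory Defs
  imports Complex_Main "HOL-Library.Landau_Symbols"
begin

text \<open>
  Nodes are the numbers \<open>0, \<dots>, n - 1\<close>. Port \<open>(i, Minus)\<close> is \<open>q\<^sub>i\<^sub>-\<close> and leads to node \<open>i - 1\<close>; port
  \<open>(i, Plus)\<close> is \<open>q\<^sub>i\<^sub>+\<close> and leads to node \<open>i + 1\<close> (modulo \<open>n\<close>). Edge \<open>e\<close> joins \<open>e\<close> and \<open>e + 1\<close>.
  Agents never see node numbers, edge numbers or sides, only the directions which their private
  orientation assigns to ports.
\<close>

datatype side = Minus | Plus

type_synonym port = "nat \<times> side"

fun far_end :: "nat \<Rightarrow> port \<Rightarrow> nat" where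
  "far_end n (i, Plus) = (i + 1) mod n"
| "far_end n (i, Minus) = (i + n - 1) mod n"

fun edge_at :: "nat \<Rightarrow> port \<Rightarrow> nat" where
  "edge_at n (i, Plus) = i"
| "edge_at n (i, Minus) = (i + n - 1) mod n"

datatype agent = Agent1 | Agent2

fun other :: "agent \<Rightarrow> agent" where
  "other Agent1 = Agent2"
| "other Agent2 = Agent1"

datatype dir = Left | Right

type_synonym orientation = "port \<Rightarrow> dir"

definition consistent :: "nat \<Rightarrow> orientation \<Rightarrow> bool" where
  "consistent n lam \<longleftrightarrow>
     (\<forall>i<n. lam (i, Minus) \<noteq> lam (i, Plus)) \<and>
     (\<forall>i<n. \<forall>k<n. \<forall>s. lam (i, s) = lam (k, s))"

definition chirality :: "nat \<Rightarrow> (agent \<Rightarrow> orientation) \<Rightarrow> bool" where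
  "chirality n lam \<longleftrightarrow> (\<forall>i<n. \<forall>s. \<forall>a b. lam a (i, s) = lam b (i, s))"

definition port_towards :: "orientation \<Rightarrow> nat \<Rightarrow> dir \<Rightarrow> port" where
  "port_towards lam v d = (v, if lam (v, Minus) = d then Minus else Plus)"

datatype control = Init | Bounce | Reverse | Terminate

text \<open>
  Nodes being anonymous, what an agent perceives as distinct nodes are distinct net displacements
  (counted rightwards) from its starting node; \<open>seen\<close> collects those met so far. \<open>None\<close> in
  \<open>leftSteps\<close> and \<open>rightSteps\<close> stands for \<open>\<bottom>\<close>.
\<close>

record memory =
  control :: control
  leftSteps :: "nat option"
  rightSteps :: "nat option"
  Esteps :: nat
  wait :: nat
  disp :: int
  seen :: "int set"

definition initial_memory :: memory where
  "initial_memory =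
     \<lparr>control = Init, leftSteps = None, rightSteps = None, Esteps = 0, wait = 0,
      disp = 0, seen = {0}\<rparr>"

definition Tnodes :: "memory \<Rightarrow> nat" where
  "Tnodes m = card (seen m)"

text \<open>
  \<open>own\<close> is \<open>None\<close> for an agent inside its node, and \<open>Some d\<close> for an agent on the port of direction
  \<open>d\<close>. \<open>met\<close> is \<open>None\<close> if the other agent is not at this node, and otherwise \<open>Some p\<close> with \<open>p\<close>
  encoding its position in the same way as \<open>own\<close>.
\<close>

record snapshot =
  own :: "dir option"
  met :: "dir option option"

definition Btime :: "snapshot \<Rightarrow> memory \<Rightarrow> nat" where
  "Btime sn m = (if own sn = None then 0 else wait m)"

definition catches :: "snapshot \<Rightarrow> dir \<Rightarrow> bool" where
  "catches sn d \<longleftrightarrow> own sn = None \<and> met sn = Some (Some d)"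

fun explore_dir :: "control \<Rightarrow> dir option" where
  "explore_dir Init = Some Left"
| "explore_dir Bounce = Some Right"
| "explore_dir Reverse = Some Left"
| "explore_dir Terminate = None"

text \<open>The state to which the current call of Explore exits; \<open>None\<close> if no predicate is satisfied.\<close>

fun explore_exit :: "nat \<Rightarrow> snapshot \<Rightarrow> memory \<Rightarrow> control \<Rightarrow> control option" where
  "explore_exit N sn m Init =
     (if Tnodes m \<ge> N then Some Terminate else if catches sn Left then Some Bounce else None)"
| "explore_exit N sn m Bounce =
     (if Tnodes m \<ge> N then Some Terminate else if Btime sn m > 0 then Some Reverse else None)"
| "explore_exit N sn m Reverse =
     (if Tnodes m \<ge> N then Some Terminate else if catches sn Left then Some Bounce else None)"
| "explore_exit N sn m Terminate = None"

text \<open>The assignments made on entering a state, up to and including the new call of Explore.\<close>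

fun enter :: "control \<Rightarrow> memory \<Rightarrow> memory" where
  "enter Init m = m\<lparr>control := Init, Esteps := 0\<rparr>"
| "enter Bounce m =
     (let m' = m\<lparr>leftSteps := Some (Esteps m)\<rparr>
      in if (case rightSteps m' of None \<Rightarrow> False | Some r \<Rightarrow> r \<ge> Esteps m)
         then m'\<lparr>control := Terminate\<rparr>
         else m'\<lparr>control := Bounce, Esteps := 0\<rparr>)"
| "enter Reverse m = m\<lparr>rightSteps := Some (Esteps m), control := Reverse, Esteps := 0\<rparr>"
| "enter Terminate m = m\<lparr>control := Terminate\<rparr>"

text \<open>
  A transition takes no round: the Explore of the state entered is evaluated on the same snapshot.
  This cannot go on forever, since Reverse exits to Bounce only inside a node, and Bounce to Reverse
  only on a port.
\<close>

function compute :: "nat \<Rightarrow> snapshot \<Rightarrow> memory \<Rightarrow> memory \<times> dir option" where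
  "compute N sn m =
     (case explore_exit N sn m (control m) of
        None \<Rightarrow> (m, explore_dir (control m))
      | Some s \<Rightarrow> compute N sn (enter s m))"
  by pat_completeness auto

termination
proof (relation "measure (\<lambda>(N, sn, m). case control m of
      Terminate \<Rightarrow> 0
    | Bounce \<Rightarrow> (if own sn = None then 1 else 2)
    | _ \<Rightarrow> (if own sn = None then 2 else 1))")
  fix N sn m s
  assume "explore_exit N sn m (control m) = Some s"
  then show "((N, sn, enter s m), (N, sn, m)) \<in> measure (\<lambda>(N, sn, m). case control m of
      Terminate \<Rightarrow> 0
    | Bounce \<Rightarrow> (if own sn = None then 1 else 2)
    | _ \<Rightarrow> (if own sn = None then 2 else 1))"
    by (cases "control m")
       (auto simp: catches_def Btime_def Let_def split: if_splits option.splits)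
qed simp

declare compute.simps [simp del]

datatype place = InNode nat | OnPort port

fun node_of :: "place \<Rightarrow> nat" where
  "node_of (InNode v) = v"
| "node_of (OnPort p) = fst p"

record configuration =
  place :: "agent \<Rightarrow> place"
  mem :: "agent \<Rightarrow> memory"

text \<open>
  The choices of the adversary for each round: the missing edge (if any), the activated agents, and
  the agent favoured if both try to access the same port.
\<close>

record adversary =
  missing :: "nat \<Rightarrow> nat option"
  active :: "nat \<Rightarrow> agent set"
  favoured :: "nat \<Rightarrow> agent"

definition legal :: "nat \<Rightarrow> adversary \<Rightarrow> bool" where
  "legal n adv \<longleftrightarrow>
     (\<forall>t e. missing adv t = Some e \<longrightarrow> e < n) \<and>
     (\<forall>t. active adv t \<noteq> {}) \<and>
     (\<forall>a. infinite {t. a \<in> active adv t})"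

fun seen_as :: "orientation \<Rightarrow> place \<Rightarrow> dir option" where
  "seen_as lam (InNode v) = None"
| "seen_as lam (OnPort p) = Some (lam p)"

definition look :: "(agent \<Rightarrow> orientation) \<Rightarrow> configuration \<Rightarrow> agent \<Rightarrow> snapshot" where
  "look lam c a =
     \<lparr>own = seen_as (lam a) (place c a),
      met = (if node_of (place c (other a)) = node_of (place c a)
             then Some (seen_as (lam a) (place c (other a))) else None)\<rparr>"

definition computed ::
  "nat \<Rightarrow> (agent \<Rightarrow> orientation) \<Rightarrow> agent set \<Rightarrow> configuration \<Rightarrow> agent \<Rightarrow> memory \<times> dir option"
where
  "computed N lam act c a =
     (if a \<in> act then compute N (look lam c a) (mem c a) else (mem c a, None))"

definition request ::
  "nat \<Rightarrow> (agent \<Rightarrow> orientation) \<Rightarrow> agent set \<Rightarrow> configuration \<Rightarrow> agent \<Rightarrow> port option"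
where
  "request N lam act c a =
     (case snd (computed N lam act c a) of
        None \<Rightarrow> None
      | Some d \<Rightarrow>
          let p = port_towards (lam a) (node_of (place c a)) d
          in if place c a = OnPort p then None else Some p)"

text \<open>
  Positions between Compute and Move. A port occupied at the beginning of the round cannot be gained
  in that round. An agent that leaves a port in order to access the other one, and fails, is left
  inside the node.
\<close>

definition accessed ::
  "nat \<Rightarrow> (agent \<Rightarrow> orientation) \<Rightarrow> agent set \<Rightarrow> agent \<Rightarrow> configuration \<Rightarrow> agent \<Rightarrow> place"
where
  "accessed N lam act fav c a =
     (case request N lam act c a of
        None \<Rightarrow> place c a
      | Some p \<Rightarrow>
          if place c (other a) \<noteq> OnPort p \<and>
             (request N lam act c (other a) = Some p \<longrightarrow> fav = a)
          then OnPort p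
          else InNode (node_of (place c a)))"

definition crosses :: "nat \<Rightarrow> nat option \<Rightarrow> place \<Rightarrow> bool" where
  "crosses n miss q \<longleftrightarrow> (\<exists>p. q = OnPort p \<and> miss \<noteq> Some (edge_at n p))"

fun step_towards :: "dir \<Rightarrow> int" where
  "step_towards Left = - 1"
| "step_towards Right = 1"

text \<open>
  \<open>move n lam miss old q m\<close> gives the new place and memory of an agent that was at \<open>old\<close> when the
  round began and is at \<open>q\<close> after Compute. An agent asleep on a port is moved in the same way
  (passive transport); it can tell afterwards, as it fell asleep on a port and wakes up in a node,
  so the bookkeeping is done at once.
\<close>

fun move :: "nat \<Rightarrow> orientation \<Rightarrow> nat option \<Rightarrow> place \<Rightarrow> place \<Rightarrow> memory \<Rightarrow> place \<times> memory"
where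
  "move n lam miss old (InNode v) m = (InNode v, m\<lparr>wait := 0\<rparr>)"
| "move n lam miss old (OnPort p) m =
     (if crosses n miss (OnPort p)
      then (InNode (far_end n p),
            let x = disp m + step_towards (lam p)
            in m\<lparr>Esteps := Esteps m + 1, wait := 0, disp := x, seen := insert x (seen m)\<rparr>)
      else (OnPort p, m\<lparr>wait := (if old = OnPort p then wait m + 1 else 1)\<rparr>))"

definition moved_agent ::
  "nat \<Rightarrow> nat \<Rightarrow> (agent \<Rightarrow> orientation) \<Rightarrow> adversary \<Rightarrow> nat \<Rightarrow> configuration \<Rightarrow> agent \<Rightarrow>
   place \<times> memory"
where
  "moved_agent n N lam adv t c a =
     move n (lam a) (missing adv t) (place c a)
       (accessed N lam (active adv t) (favoured adv t) c a)
       (fst (computed N lam (active adv t) c a))"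

definition next_configuration ::
  "nat \<Rightarrow> nat \<Rightarrow> (agent \<Rightarrow> orientation) \<Rightarrow> adversary \<Rightarrow> nat \<Rightarrow> configuration \<Rightarrow> configuration"
where
  "next_configuration n N lam adv t c =
     \<lparr>place = (\<lambda>a. fst (moved_agent n N lam adv t c a)),
      mem = (\<lambda>a. snd (moved_agent n N lam adv t c a))\<rparr>"

text \<open>\<open>run \<dots> t\<close> is the configuration at the beginning of round \<open>t\<close>.\<close>

primrec run ::
  "nat \<Rightarrow> nat \<Rightarrow> (agent \<Rightarrow> orientation) \<Rightarrow> (agent \<Rightarrow> nat) \<Rightarrow> adversary \<Rightarrow> nat \<Rightarrow> configuration"
where
  "run n N lam start adv 0 = \<lparr>place = (\<lambda>a. InNode (start a)), mem = (\<lambda>a. initial_memory)\<rparr>"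
| "run n N lam start adv (Suc t) =
     next_configuration n N lam adv t (run n N lam start adv t)"

definition explored_by :: "nat \<Rightarrow> (nat \<Rightarrow> configuration) \<Rightarrow> nat \<Rightarrow> bool" where
  "explored_by n R t \<longleftrightarrow> (\<forall>v<n. \<exists>s\<le>t. \<exists>a. node_of (place (R s) a) = v)"

definition traversals ::
  "nat \<Rightarrow> nat \<Rightarrow> (agent \<Rightarrow> orientation) \<Rightarrow> (agent \<Rightarrow> nat) \<Rightarrow> adversary \<Rightarrow> nat \<Rightarrow> nat"
where
  "traversals n N lam start adv T =
     (\<Sum>t<T. card {a. crosses n (missing adv t)
        (accessed N lam (active adv t) (favoured adv t) (run n N lam start adv t) a)})"

definition terminated :: "configuration \<Rightarrow> agent \<Rightarrow> bool" where
  "terminated c a \<longleftrightarrow> control (mem c a) = Terminate"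

text \<open>The ring must be explored before the round in which the terminal state is entered.\<close>

definition explicitly_terminates :: "nat \<Rightarrow> (nat \<Rightarrow> configuration) \<Rightarrow> agent \<Rightarrow> bool" where
  "explicitly_terminates n R a \<longleftrightarrow>
     (\<exists>t. \<not> terminated (R t) a \<and> explored_by n R t \<and>
          (\<forall>t'>t. terminated (R t') a \<and> place (R t') a = place (R (Suc t)) a))"

definition waits_perpetually :: "(nat \<Rightarrow> configuration) \<Rightarrow> agent \<Rightarrow> bool" where
  "waits_perpetually R a \<longleftrightarrow> (\<exists>t p. \<forall>t'\<ge>t. place (R t') a = OnPort p)"

end

theory Submission
  imports Defs "HOL-Library.Infinite_Set" "HOL-Number_Theory.Cong"
begin

text \<open>
  Cost. If an agent bounces, walks \<open>r\<close> steps right, reverses and catches again after \<open>l\<close> steps left,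
  then it terminates unless \<open>l > r\<close>. So its bounces take place further and further left; at most \<open>N\<close>
  displacements being met, there are at most \<open>N\<close> bounces, and a cycle between two of them costs less
  than \<open>2 * N\<close>.

  Safety. When an agent catches the other, lift both positions to the same point of the universal
  cover. While the ring is unexplored, agents meet only if they meet in the cover. The caught agent sits
  on its left port and moves only left until it bounces itself; if it has not moved when the bouncing agent
  gets blocked, both are blocked by the same edge, so that they have surrounded the ring. Hence \<open>l > r\<close>
  at the next catch: termination by \<open>l \<le> r\<close> implies exploration.

  Liveness. Moves and then transitions eventually cease. An agent that is not terminated is then stuck
  on a left port, and both cannot be so, as only one edge is missing in a round.
\<close>

section \<open>Compute unfolded, state by state\<close>

definition left_moving :: "control \<Rightarrow> bool" where
  "left_moving s \<longleftrightarrow> s = Init \<or> s = Reverse"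

lemma compute_Terminate:
  "control m = Terminate \<Longrightarrow> compute N sn m = (m, None)"
  by (simp add: compute.simps)

text \<open>Bounce is entered inside a node, where \<open>Btime\<close> is 0, and
  \<open>Tnodes\<close> is unchanged; so the new call of Explore cannot exit on the same snapshot
  and one further unfolding suffices.\<close>

lemma compute_left_moving:
  assumes "left_moving (control m)"
  shows "compute N sn m =
    (if Tnodes m \<ge> N then (m\<lparr>control := Terminate\<rparr>, None)
     else if catches sn Left then
       (enter Bounce m, if control (enter Bounce m) = Terminate then None else Some Right)
     else (m, Some Left))"
proof -
  have T: "Tnodes (enter Bounce m) = Tnodes m"
    by (simp add: Tnodes_def Let_def)
  have B: "control (enter Bounce m) \<in> {Terminate, Bounce}"
    by (simp add: Let_def)
  have "compute N sn (enter Bounce m) =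
      (enter Bounce m, if control (enter Bounce m) = Terminate then None else Some Right)"
    if "catches sn Left" "\<not> Tnodes m \<ge> N"
  proof (cases "control (enter Bounce m) = Terminate")
    case True
    then show ?thesis by (simp add: compute_Terminate del: enter.simps)
  next
    case False
    with B have "control (enter Bounce m) = Bounce" by blast
    with that T show ?thesis
      by (subst compute.simps) (simp add: Btime_def catches_def del: enter.simps)
  qed
  then show ?thesis
    using assms unfolding left_moving_def
    by (subst compute.simps) (auto simp: compute_Terminate simp del: enter.simps(2))
qed

text \<open>Reverse is entered only on a port, where \<open>catches\<close> is false, so the chain
  of transitions stops there.\<close>

lemma compute_Bounce:
  assumes "control m = Bounce"
  shows "compute N sn m =
    (if Tnodes m \<ge> N then (m\<lparr>control := Terminate\<rparr>, None)
     else if Btime sn m > 0 then (enter Reverse m, Some Left)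
     else (m, Some Right))"
proof -
  have "compute N sn (enter Reverse m) = (enter Reverse m, Some Left)"
    if "Btime sn m > 0" "\<not> Tnodes m \<ge> N"
    using that
    by (subst compute_left_moving)
       (auto simp: left_moving_def Tnodes_def Btime_def catches_def split: if_splits)
  then show ?thesis
    using assms by (subst compute.simps) (auto simp: compute_Terminate simp del: enter.simps(3))
qed

lemma control_cases:
  obtains "left_moving s" | "s = Bounce" | "s = Terminate"
  by (cases s) (auto simp: left_moving_def)

section \<open>Cost\<close>

text \<open>
  \<open>k\<close> counts the traversals of the agent. The displacement at the last bounce is \<open>disp - Esteps\<close> in
  state Bounce and \<open>disp + Esteps - rightSteps\<close> in state Reverse; it decreases by at least one from
  each bounce to the next, and a cycle between two bounces costs at most \<open>2 * N\<close>.
\<close>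

definition cost_invariant :: "nat \<Rightarrow> memory \<Rightarrow> nat \<Rightarrow> bool" where
  "cost_invariant N m k \<longleftrightarrow>
     (\<exists>lo hi. seen m = {lo..hi} \<and> lo \<le> 0 \<and> 0 \<le> hi \<and> lo \<le> disp m \<and> disp m \<le> hi \<and>
        hi - lo < int N \<and>
        (case control m of
           Init \<Rightarrow> rightSteps m = None \<and> disp m = - int (Esteps m) \<and> k = Esteps m
         | Bounce \<Rightarrow> lo \<le> disp m - int (Esteps m) \<and>
             int k \<le> 2 * int N * (1 - (disp m - int (Esteps m))) + int (Esteps m)
         | Reverse \<Rightarrow> (\<exists>r. rightSteps m = Some r \<and> lo \<le> disp m + int (Esteps m) - int r \<and>
             disp m + int (Esteps m) \<le> hi \<and>
             int k \<le> 2 * int N * (1 - (disp m + int (Esteps m) - int r)) + int r + int (Esteps m))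
         | Terminate \<Rightarrow> int k \<le> 2 * int N * int N + 2 * int N))"

text \<open>Amortisation: \<open>b\<close> and \<open>c\<close> are the displacements at two
  successive bounces. Going at least one further left raises the potential by \<open>2 * N\<close>,
  which pays for the cost \<open>s\<close> of a cycle.\<close>

lemma mult_gap_le:
  fixes b c :: int
  assumes "c < b" "s \<le> 2 * int N"
  shows "2 * int N * (1 - b) + s \<le> 2 * int N * (1 - c)"
proof -
  have "2 * int N * 1 \<le> 2 * int N * (b - c)"
    using assms(1) by (intro mult_left_mono) auto
  then show ?thesis using assms(2) by (simp add: algebra_simps)
qed

lemma cost_invariant_bound:
  assumes "cost_invariant N m k"
  shows "int k \<le> 2 * int N * int N + 2 * int N"
proof -
  obtain lo hi where I: "lo \<le> 0" "0 \<le> hi" "lo \<le> disp m" "disp m \<le> hi" "hi - lo < int N"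
    and C: "case control m of
           Init \<Rightarrow> rightSteps m = None \<and> disp m = - int (Esteps m) \<and> k = Esteps m
         | Bounce \<Rightarrow> lo \<le> disp m - int (Esteps m) \<and>
             int k \<le> 2 * int N * (1 - (disp m - int (Esteps m))) + int (Esteps m)
         | Reverse \<Rightarrow> (\<exists>r. rightSteps m = Some r \<and> lo \<le> disp m + int (Esteps m) - int r \<and>
             disp m + int (Esteps m) \<le> hi \<and>
             int k \<le> 2 * int N * (1 - (disp m + int (Esteps m) - int r)) + int r + int (Esteps m))
         | Terminate \<Rightarrow> int k \<le> 2 * int N * int N + 2 * int N"
    using assms unfolding cost_invariant_def by blast
  \<comment> \<open>Since \<open>{lo..hi}\<close> contains 0 and \<open>hi - lo < N\<close>, every
    bounce displacement \<open>b\<close> exceeds \<open>- N\<close>, which is the instance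
    \<open>1 - int N - 1\<close>.\<close>
  have P: "2 * int N * (1 - b) + s \<le> 2 * int N * int N + 2 * int N"
    if "lo \<le> b" "s \<le> 2 * int N" for b s
    using mult_gap_le[of "1 - int N - 1" b s N] mult_left_mono[of "1 - b" "int N" "2 * int N"] that I
    by (simp add: algebra_simps)
  show ?thesis
  proof (cases "control m")
    case Init
    have "0 \<le> 2 * int N * int N" by simp
    moreover have "int k = - disp m" using Init C by simp
    ultimately show ?thesis using I by linarith
  next
    case Bounce
    with C P[of "disp m - int (Esteps m)" "int (Esteps m)"] I show ?thesis by auto
  next
    case Reverse
    with C obtain r where "lo \<le> disp m + int (Esteps m) - int r" "disp m + int (Esteps m) \<le> hi"
      "int k \<le> 2 * int N * (1 - (disp m + int (Esteps m) - int r)) + int r + int (Esteps m)"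
      by auto
    with P[of "disp m + int (Esteps m) - int r" "int r + int (Esteps m)"] I show ?thesis by auto
  next
    case Terminate
    with C show ?thesis by auto
  qed
qed

lemma cost_invariant_initial: "0 < N \<Longrightarrow> cost_invariant N initial_memory 0"
  unfolding cost_invariant_def initial_memory_def by (intro exI[of _ 0]) auto

lemma cost_invariant_wait: "cost_invariant N (m\<lparr>wait := w\<rparr>) k \<longleftrightarrow> cost_invariant N m k"
  by (simp add: cost_invariant_def cong: control.case_cong)

lemma cost_invariant_Terminate:
  assumes "cost_invariant N m k"
  shows "cost_invariant N (m\<lparr>control := Terminate\<rparr>) k"
  using assms cost_invariant_bound[OF assms] by (auto simp: cost_invariant_def)

lemma cost_invariant_Bounce:
  assumes "cost_invariant N m k" "left_moving (control m)"
  shows "cost_invariant N (enter Bounce m) k"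
proof (cases "control (enter Bounce m) = Terminate")
  case True
  with assms(1) cost_invariant_bound[OF assms(1)] show ?thesis
    by (auto simp: cost_invariant_def Let_def)
next
  case False
  obtain lo hi where I: "seen m = {lo..hi}" "lo \<le> 0" "0 \<le> hi" "lo \<le> disp m" "disp m \<le> hi"
      "hi - lo < int N"
    and Init: "control m = Init \<Longrightarrow>
      rightSteps m = None \<and> disp m = - int (Esteps m) \<and> k = Esteps m"
    and Reverse: "control m = Reverse \<Longrightarrow>
      (\<exists>r. rightSteps m = Some r \<and> lo \<le> disp m + int (Esteps m) - int r \<and>
             disp m + int (Esteps m) \<le> hi \<and>
             int k \<le> 2 * int N * (1 - (disp m + int (Esteps m) - int r)) + int r + int (Esteps m))"
    using assms(1) unfolding cost_invariant_def by (cases "control m") auto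
  have "int k \<le> 2 * int N * (1 - disp m)"
  proof (cases "control m = Init")
    case True
    \<comment> \<open>The first bounce takes place at displacement \<open>- Esteps\<close>, and the
      potential there already covers the cost \<open>Esteps\<close>.\<close>
    have "1 * int (Esteps m) \<le> 2 * int N * (1 + int (Esteps m))"
      using I by (intro mult_mono) auto
    with Init True show ?thesis by simp
  next
    case F: False
    with assms(2) Reverse obtain r where r: "rightSteps m = Some r"
      "lo \<le> disp m + int (Esteps m) - int r" "disp m + int (Esteps m) \<le> hi"
      "int k \<le> 2 * int N * (1 - (disp m + int (Esteps m) - int r)) + (int r + int (Esteps m))"
      by (auto simp: left_moving_def algebra_simps)
    \<comment> \<open>Passing the test without terminating puts the new bounce strictly left of the
      last one. Both \<open>r\<close> and \<open>Esteps\<close> are distances inside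
      \<open>{lo..hi}\<close>, so the cycle costs at most \<open>2 * N\<close>.\<close>
    with False have "r < Esteps m"
      by (auto simp: Let_def split: if_splits)
    with r mult_gap_le[of "disp m" "disp m + int (Esteps m) - int r" "int r + int (Esteps m)" N] I
    show ?thesis by auto
  qed
  with False I show ?thesis
    by (auto simp: cost_invariant_def Let_def split: if_splits)
qed

lemma cost_invariant_Reverse:
  assumes "cost_invariant N m k" "control m = Bounce"
  shows "cost_invariant N (enter Reverse m) k"
  using assms by (auto simp: cost_invariant_def)

lemma cost_invariant_move:
  assumes "cost_invariant N m k" "Tnodes m < N" "explore_dir (control m) = Some d"
  shows "cost_invariant N (m\<lparr>Esteps := Esteps m + 1, wait := w, disp := disp m + step_towards d,
    seen := insert (disp m + step_towards d) (seen m)\<rparr>) (Suc k)"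
proof -
  obtain lo hi where I: "seen m = {lo..hi}" "lo \<le> 0" "0 \<le> hi" "lo \<le> disp m" "disp m \<le> hi"
    and C: "case control m of
           Init \<Rightarrow> rightSteps m = None \<and> disp m = - int (Esteps m) \<and> k = Esteps m
         | Bounce \<Rightarrow> lo \<le> disp m - int (Esteps m) \<and>
             int k \<le> 2 * int N * (1 - (disp m - int (Esteps m))) + int (Esteps m)
         | Reverse \<Rightarrow> (\<exists>r. rightSteps m = Some r \<and> lo \<le> disp m + int (Esteps m) - int r \<and>
             disp m + int (Esteps m) \<le> hi \<and>
             int k \<le> 2 * int N * (1 - (disp m + int (Esteps m) - int r)) + int r + int (Esteps m))
         | Terminate \<Rightarrow> int k \<le> 2 * int N * int N + 2 * int N"
    using assms(1) unfolding cost_invariant_def by blast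
  \<comment> \<open>Having seen fewer than \<open>N\<close> nodes leaves room for the interval to
    grow by one.\<close>
  have w: "hi - lo + 1 < int N"
    using assms(2) I(2,3) unfolding Tnodes_def I(1) by simp
  define x where "x = disp m + step_towards d"
  have x: "x = disp m + 1 \<or> x = disp m - 1"
    by (cases d) (auto simp: x_def)
  have S: "insert x (seen m) = {min lo x..max hi x}"
  proof (rule set_eqI)
    fix z
    show "z \<in> insert x (seen m) \<longleftrightarrow> z \<in> {min lo x..max hi x}"
      unfolding I(1) using x I(4,5) by (simp only: insert_iff atLeastAtMost_iff) linarith
  qed
  show ?thesis
  proof (cases "control m")
    case Init
    then show ?thesis using C assms(3) I w S
      unfolding cost_invariant_def x_def[symmetric]
      by (intro exI[of _ "min lo x"] exI[of _ "max hi x"]) (auto simp: x_def)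
  next
    case Bounce
    then have "x = disp m + 1" using assms(3) by (auto simp: x_def)
    with Bounce C I w S show ?thesis
      unfolding cost_invariant_def x_def[symmetric]
      by (intro exI[of _ "min lo x"] exI[of _ "max hi x"]) auto
  next
    case Reverse
    then have x: "x = disp m - 1" using assms(3) by (auto simp: x_def)
    from Reverse C obtain r where r: "rightSteps m = Some r"
      "lo \<le> disp m + int (Esteps m) - int r" "disp m + int (Esteps m) \<le> hi"
      "int k \<le> 2 * int N * (1 - (disp m + int (Esteps m) - int r)) + int r + int (Esteps m)"
      by auto
    with Reverse I w S x show ?thesis
      unfolding cost_invariant_def x_def[symmetric]
      by (intro exI[of _ "min lo x"] exI[of _ "max hi x"]) auto
  next
    case Terminate
    then show ?thesis using assms(3) by simp
  qed
qed

section \<open>Ranking functions for the liveness argument\<close>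

lemma eventually_constant_nat:
  fixes f :: "nat \<Rightarrow> nat"
  assumes "\<And>t. T \<le> t \<Longrightarrow> f (Suc t) \<le> f t"
  shows "\<exists>T'\<ge>T. \<forall>t\<ge>T'. f (Suc t) = f t"
proof -
  obtain s where s: "T \<le> s" "\<And>t. T \<le> t \<Longrightarrow> f s \<le> f t"
    using ex_has_least_nat[of "\<lambda>t. T \<le> t" T f] by auto
  have "f t \<le> f s" if "s \<le> t" for t
    using that
  proof (induction t rule: dec_induct)
    case (step t)
    then have "f (Suc t) \<le> f t" using assms s(1) by simp
    with step show ?case by simp
  qed simp
  then have const: "f t = f s" if "s \<le> t" for t
    using that s by (meson le_antisym order_trans)
  show ?thesis
  proof (intro exI[of _ s] conjI allI impI)
    show "f (Suc t) = f t" if "s \<le> t" for t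
      using const[OF that] const[of "Suc t"] that by simp
  qed (rule s(1))
qed

text \<open>Decreases at every transition, as a state Reverse entered on a port starts with \<open>Esteps = 0\<close>.\<close>

definition transitions_left :: "memory \<Rightarrow> nat" where
  "transitions_left m = (case control m of
     Init \<Rightarrow> 3
   | Bounce \<Rightarrow> 2
   | Reverse \<Rightarrow> (case rightSteps m of None \<Rightarrow> 3 | Some r \<Rightarrow> if Esteps m \<le> r then 1 else 3)
   | Terminate \<Rightarrow> 0)"

section \<open>Rounds\<close>

locale chiral_run =
  fixes n N :: nat and lam :: "agent \<Rightarrow> orientation" and start :: "agent \<Rightarrow> nat"
    and adv :: adversary
  assumes n_ge_2: "2 \<le> n" and n_le_N: "n \<le> N"
    and consistent: "\<And>a. consistent n (lam a)" and chirality: "chirality n lam"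
    and start: "\<And>a. start a < n" and legal: "legal n adv"
begin

section \<open>Ports and edges in arithmetic modulo \<open>n\<close>\<close>

definition side_of :: "dir \<Rightarrow> side" where
  "side_of d = (if lam Agent1 (0, Minus) = d then Minus else Plus)"

text \<open>Converts displacements, counted rightwards, into node numbers. Consistency and chirality
  make the side of a direction the same everywhere, so node 0 and \<open>Agent1\<close> serve as
  reference.\<close>

definition sign :: int where
  "sign = (if lam Agent1 (0, Minus) = Left then 1 else - 1)"

lemma sign_cases: "sign = 1 \<or> sign = - 1"
  by (simp add: sign_def)

lemma lam_Agent1: "i < n \<Longrightarrow> lam a (i, s) = lam Agent1 (0, s)"
  using chirality consistent[of Agent1] n_ge_2
  unfolding chirality_def consistent_def by (metis gr_zeroI not_numeral_le_zero)

lemma lam_Plus: "lam Agent1 (0, Plus) \<noteq> lam Agent1 (0, Minus)"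
  using consistent[of Agent1] n_ge_2
  unfolding consistent_def by (metis gr_zeroI not_numeral_le_zero)

lemma lam_side_of: "i < n \<Longrightarrow> lam a (i, side_of d) = d"
  using lam_Plus lam_Agent1[of i a "side_of d"]
  by (cases d; cases "lam Agent1 (0, Minus)"; cases "lam Agent1 (0, Plus)")
     (auto simp: side_of_def)

lemma side_of_inj: "side_of d = side_of e \<longleftrightarrow> d = e"
  using lam_side_of[of 0 Agent1] n_ge_2 by (metis gr_zeroI not_numeral_le_zero)

lemma port_towards: "i < n \<Longrightarrow> port_towards (lam a) i d = (i, side_of d)"
  using lam_Agent1[of i a Minus] by (simp add: port_towards_def side_of_def)

lemma far_end_less: "far_end n p < n"
  using n_ge_2 by (cases "(n, p)" rule: far_end.cases) auto

lemma pred_mod: "[int ((i + n - 1) mod n) = int i - 1] (mod int n)"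
proof -
  have "int ((i + n - 1) mod n) = (int i - 1 + int n) mod int n"
    using n_ge_2 by (simp add: zmod_int of_nat_diff algebra_simps)
  then show ?thesis by (simp add: cong_def)
qed

lemma succ_mod: "[int ((i + 1) mod n) = int i + 1] (mod int n)"
  by (simp add: cong_def zmod_int add.commute)

lemma side_of_step:
  "side_of d = (if sign * step_towards d = 1 then Plus else Minus)"
  "sign * step_towards d = 1 \<or> sign * step_towards d = - 1"
  by (cases d; cases "lam Agent1 (0, Minus)"; simp add: side_of_def sign_def)+

lemma far_end_cong:
  "[int (far_end n (i, side_of d)) = int i + sign * step_towards d] (mod int n)"
  using side_of_step[of d] succ_mod[of i] pred_mod[of i] by (auto simp: add.commute)

lemma edge_at_same:
  assumes "i < n" "j < n" "edge_at n (i, side_of d) = edge_at n (j, side_of d)"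
  shows "i = j"
proof (cases "side_of d")
  case Minus
  with assms(3) have "[int i - 1 = int j - 1] (mod int n)"
    using pred_mod[of i] pred_mod[of j] by (metis cong_sym cong_trans edge_at.simps(2))
  then have "[int i = int j] (mod int n)"
    by (simp add: cong_iff_dvd_diff)
  with assms show ?thesis by (simp add: cong_int_iff cong_less_modulus_unique_nat)
qed (use assms in simp)

text \<open>What it means for one missing edge to block a right-moving and a left-moving agent at
  once: they face each other across it.\<close>

lemma edge_at_opposite:
  assumes "edge_at n (i, side_of Right) = edge_at n (j, side_of Left)"
  shows "[int i + sign = int j] (mod int n)"
proof (cases "side_of Left")
  case Minus
  with side_of_inj[of Left Right] have "side_of Right = Plus" "sign = 1"
    using sign_cases side_of_step(1)[of Left] by (cases "side_of Right"; auto)+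
  with Minus assms pred_mod[of j] show ?thesis
    by (auto simp: cong_iff_dvd_diff algebra_simps dvd_diff_commute)
next
  case Plus
  with side_of_inj[of Left Right] have "side_of Right = Minus" "sign = - 1"
    using sign_cases side_of_step(1)[of Left] by (cases "side_of Right"; auto)+
  with Plus assms pred_mod[of i] show ?thesis
    by (auto simp: cong_sym)
qed

section \<open>Analysis of a single round\<close>

abbreviation "R \<equiv> run n N lam start adv"
abbreviation "pl t a \<equiv> place (R t) a"
abbreviation "me t a \<equiv> mem (R t) a"
abbreviation "nd t a \<equiv> node_of (pl t a)"

definition computed_mem :: "nat \<Rightarrow> agent \<Rightarrow> memory" where
  "computed_mem t a = fst (computed N lam (active adv t) (R t) a)"

definition goal_dir :: "nat \<Rightarrow> agent \<Rightarrow> dir option" where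
  "goal_dir t a = snd (computed N lam (active adv t) (R t) a)"

definition accessed_place :: "nat \<Rightarrow> agent \<Rightarrow> place" where
  "accessed_place t a = accessed N lam (active adv t) (favoured adv t) (R t) a"

text \<open>Passive transport is included: an agent asleep on a port has that port as its
  \<open>accessed_place\<close>.\<close>

definition crossing :: "nat \<Rightarrow> agent \<Rightarrow> bool" where
  "crossing t a \<longleftrightarrow> crosses n (missing adv t) (accessed_place t a)"

definition moves :: "nat \<Rightarrow> agent \<Rightarrow> nat" where
  "moves t a = (\<Sum>s<t. of_bool (crossing s a))"

lemma other_ne: "other a \<noteq> a" by (cases a) auto
lemma other_other: "other (other a) = a" by (cases a) auto
lemma agent_cases: "b = a \<or> b = other a" by (cases a; cases b) auto

lemma R_Suc: "pl (Suc t) a = fst (move n (lam a) (missing adv t) (pl t a) (accessed_place t a) (computed_mem t a))"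
  "me (Suc t) a = snd (move n (lam a) (missing adv t) (pl t a) (accessed_place t a) (computed_mem t a))"
  by (simp_all add: next_configuration_def moved_agent_def computed_mem_def accessed_place_def)

text \<open>Invariant of all reachable configurations. \<open>0 < wait\<close> makes
  \<open>Btime\<close> positive at every activation on a port; \<open>Tnodes < N\<close> confines
  termination by counting to the inside of a node. It is a separate predicate because a round must
  be analysed under it before its preservation can be proved.\<close>

definition well_placed :: "nat \<Rightarrow> agent \<Rightarrow> bool" where
  "well_placed t a \<longleftrightarrow> nd t a < n \<and>
     (\<forall>p. pl t a = OnPort p \<longrightarrow>
        (\<exists>d. explore_dir (control (me t a)) = Some d \<and> p = (nd t a, side_of d)) \<and>
        0 < wait (me t a) \<and> Tnodes (me t a) < N)"

lemma seen_as_cases: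
  assumes "well_placed t a"
  shows "seen_as (lam b) (pl t a) =
    (case pl t a of InNode v \<Rightarrow> None | OnPort p \<Rightarrow> explore_dir (control (me t a)))"
  using assms lam_side_of unfolding well_placed_def by (cases "pl t a") fastforce+

lemma seen_as_eq_Some_iff:
  assumes "well_placed t a"
  shows "seen_as (lam b) (pl t a) = Some d \<longleftrightarrow> pl t a = OnPort (nd t a, side_of d)"
  using seen_as_cases[OF assms] assms side_of_inj
  unfolding well_placed_def by (cases "pl t a") auto

lemma catches_iff:
  assumes "well_placed t a" "well_placed t (other a)"
  shows "catches (look lam (R t) a) d \<longleftrightarrow>
    (\<exists>v. pl t a = InNode v) \<and> pl t (other a) = OnPort (nd t a, side_of d)"
  using seen_as_cases[OF assms(1)] seen_as_eq_Some_iff[OF assms(2)] assms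
  unfolding catches_def look_def well_placed_def
  by (cases "pl t a") (auto)

lemma Btime_iff:
  assumes "well_placed t a"
  shows "Btime (look lam (R t) a) (me t a) > 0 \<longleftrightarrow> (\<exists>p. pl t a = OnPort p)"
  using seen_as_cases[OF assms] assms
  unfolding Btime_def look_def well_placed_def by (cases "pl t a") auto

text \<open>The case \<open>stay\<close> also covers sleeping and terminated agents, so its facts
  about failed predicates are restricted to active ones.\<close>

lemma well_placed_computed_mem_cases:
  assumes "well_placed t a" "well_placed t (other a)"
  obtains (stay) "computed_mem t a = me t a"
      "goal_dir t a = (if a \<in> active adv t then explore_dir (control (me t a)) else None)"
      "a \<in> active adv t \<Longrightarrow> control (me t a) \<noteq> Terminate \<Longrightarrow> Tnodes (me t a) < N"
      "a \<in> active adv t \<Longrightarrow> left_moving (control (me t a)) \<Longrightarrow>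
        \<not> ((\<exists>v. pl t a = InNode v) \<and> pl t (other a) = OnPort (nd t a, side_of Left))"
      "a \<in> active adv t \<Longrightarrow> control (me t a) = Bounce \<Longrightarrow> (\<exists>v. pl t a = InNode v)"
    | (enough) "N \<le> Tnodes (me t a)" "computed_mem t a = (me t a)\<lparr>control := Terminate\<rparr>"
        "goal_dir t a = None" "\<exists>v. pl t a = InNode v" "control (me t a) \<noteq> Terminate"
    | (catch) "left_moving (control (me t a))" "Tnodes (me t a) < N" "\<exists>v. pl t a = InNode v"
        "pl t (other a) = OnPort (nd t a, side_of Left)" "computed_mem t a = enter Bounce (me t a)"
        "goal_dir t a = explore_dir (control (computed_mem t a))"
    | (blocked) "control (me t a) = Bounce" "Tnodes (me t a) < N"
        "pl t a = OnPort (nd t a, side_of Right)"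
        "computed_mem t a = enter Reverse (me t a)" "goal_dir t a = Some Left"
proof (cases "a \<in> active adv t")
  case False
  then show ?thesis by (intro stay) (auto simp: computed_mem_def goal_dir_def computed_def)
next
  case True
  let ?sn = "look lam (R t) a"
  have C: "computed_mem t a = fst (compute N ?sn (me t a))" "goal_dir t a = snd (compute N ?sn (me t a))"
    using True by (simp_all add: computed_mem_def goal_dir_def computed_def)
  have I: "\<exists>v. pl t a = InNode v" if "N \<le> Tnodes (me t a)"
    using assms(1) that unfolding well_placed_def by (cases "pl t a") auto
  note c = catches_iff[OF assms] Btime_iff[OF assms(1)]
  show ?thesis
  proof (cases "control (me t a)" rule: control_cases)
    case 1
    consider "N \<le> Tnodes (me t a)" | "Tnodes (me t a) < N" "catches ?sn Left"
      | "Tnodes (me t a) < N" "\<not> catches ?sn Left" by linarith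
    then show ?thesis
    proof cases
      case a: 1
      with 1 I C show ?thesis
        by (intro enough) (auto simp: compute_left_moving left_moving_def)
    next
      case 2
      have "control (enter Bounce (me t a)) \<in> {Terminate, Bounce}" by (simp add: Let_def)
      with 1 2 C c show ?thesis
        by (intro catch) (auto simp: compute_left_moving simp del: enter.simps)
    next
      case 3
      with 1 C c True show ?thesis
        by (intro stay) (auto simp: compute_left_moving left_moving_def)
    qed
  next
    case 2
    consider "N \<le> Tnodes (me t a)" | "Tnodes (me t a) < N" "Btime ?sn (me t a) > 0"
      | "Tnodes (me t a) < N" "\<not> Btime ?sn (me t a) > 0" by linarith
    then show ?thesis
    proof cases
      case a: 1
      with 2 I C show ?thesis by (intro enough) (auto simp: compute_Bounce)
    next
      case b: 2
      with c(2) obtain p where "pl t a = OnPort p" by blast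
      with assms(1) 2 have "pl t a = OnPort (nd t a, side_of Right)"
        unfolding well_placed_def by auto
      with 2 b C show ?thesis
        by (intro blocked) (auto simp: compute_Bounce simp del: enter.simps)
    next
      case 3
      with c(2) have "\<exists>v. pl t a = InNode v" by (cases "pl t a") auto
      with 2 3 C True show ?thesis
        by (intro stay) (auto simp: compute_Bounce left_moving_def)
    qed
  next
    case 3
    with C True show ?thesis
      by (intro stay) (auto simp: compute_Terminate left_moving_def)
  qed
qed

declare run.simps(2) [simp del]

lemma well_placed_computed_mem_simps:
  assumes "well_placed t a" "well_placed t (other a)"
  shows "disp (computed_mem t a) = disp (me t a)" "seen (computed_mem t a) = seen (me t a)"
    "Tnodes (computed_mem t a) = Tnodes (me t a)"
  by (rule well_placed_computed_mem_cases[OF assms]; simp add: Let_def Tnodes_def)+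

lemma well_placed_accessed_place_eq:
  assumes "well_placed t a"
  shows "accessed_place t a =
    (case goal_dir t a of None \<Rightarrow> pl t a
     | Some d \<Rightarrow>
        if pl t a = OnPort (nd t a, side_of d) then pl t a
        else if pl t (other a) \<noteq> OnPort (nd t a, side_of d) \<and>
          (request N lam (active adv t) (R t) (other a) = Some (nd t a, side_of d) \<longrightarrow>
            favoured adv t = a)
        then OnPort (nd t a, side_of d) else InNode (nd t a))"
  using assms port_towards[of "nd t a" a]
  by (auto simp: accessed_place_def accessed_def request_def goal_dir_def well_placed_def Let_def
      split: option.splits)

text \<open>A port gained is the one of the current direction, a port kept belongs to an unchanged
  state, and an active agent that has seen \<open>N\<close> nodes terminates before reaching for a
  port. This is what preserves \<open>well_placed\<close>.\<close>

lemma well_placed_accessed_place_shape: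
  assumes "well_placed t a" "well_placed t (other a)"
  shows "accessed_place t a = InNode (nd t a) \<or>
    (\<exists>d. accessed_place t a = OnPort (nd t a, side_of d) \<and> explore_dir (control (computed_mem t a)) = Some d \<and>
       Tnodes (computed_mem t a) < N)"
proof -
  have I: "v = nd t a" if "pl t a = InNode v" for v using that by simp
  have T: "control s = Terminate" if "explore_dir (control s) = None" for s :: memory
    using that by (cases "control s") auto
  show ?thesis
    using assms
  proof (cases rule: well_placed_computed_mem_cases)
    case stay
    show ?thesis
    proof (cases "goal_dir t a")
      case None
      then have "accessed_place t a = pl t a" by (simp add: well_placed_accessed_place_eq[OF assms(1)])
      with stay(1) assms(1) show ?thesis
        unfolding well_placed_def by (cases "pl t a") auto
    next
      case (Some d)
      with stay(2) have "explore_dir (control (computed_mem t a)) = Some d" "a \<in> active adv t"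
        using stay(1) by (auto split: if_splits)
      moreover from this have "Tnodes (computed_mem t a) < N"
        using stay(1,3) by (cases "control (me t a)") auto
      ultimately show ?thesis
        using Some by (simp add: well_placed_accessed_place_eq[OF assms(1)])
    qed
  next
    case enough
    then show ?thesis by (auto simp: well_placed_accessed_place_eq[OF assms(1)])
  next
    case catch
    have "Tnodes (computed_mem t a) < N" using catch well_placed_computed_mem_simps[OF assms] by simp
    show ?thesis
    proof (cases "goal_dir t a")
      case None
      with catch(3) show ?thesis by (auto simp: well_placed_accessed_place_eq[OF assms(1)])
    next
      case (Some d)
      have "explore_dir (control (computed_mem t a)) = Some d" using Some catch(6) by simp
      with Some \<open>Tnodes (computed_mem t a) < N\<close> show ?thesis
        by (simp add: well_placed_accessed_place_eq[OF assms(1)])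
    qed
  next
    case blocked
    have "Tnodes (computed_mem t a) < N" using blocked well_placed_computed_mem_simps[OF assms] by simp
    with blocked show ?thesis
      by (auto simp: well_placed_accessed_place_eq[OF assms(1)])
  qed
qed

lemma well_placed_crossing_step:
  assumes "well_placed t a" "well_placed t (other a)" "crossing t a"
  obtains d where "accessed_place t a = OnPort (nd t a, side_of d)"
    "explore_dir (control (computed_mem t a)) = Some d" "Tnodes (computed_mem t a) < N"
    "missing adv t \<noteq> Some (edge_at n (nd t a, side_of d))"
    "pl (Suc t) a = InNode (far_end n (nd t a, side_of d))"
    "me (Suc t) a = (computed_mem t a)\<lparr>Esteps := Esteps (computed_mem t a) + 1, wait := 0,
       disp := disp (computed_mem t a) + step_towards d,
       seen := insert (disp (computed_mem t a) + step_towards d) (seen (computed_mem t a))\<rparr>"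
proof -
  from assms(3) obtain d where d: "accessed_place t a = OnPort (nd t a, side_of d)"
    "explore_dir (control (computed_mem t a)) = Some d" "Tnodes (computed_mem t a) < N"
    using well_placed_accessed_place_shape[OF assms(1,2)] by (auto simp: crossing_def crosses_def)
  moreover have "nd t a < n" using assms(1) by (simp add: well_placed_def)
  moreover have "crosses n (missing adv t) (OnPort (nd t a, side_of d))"
    using assms(3) d(1) by (simp add: crossing_def)
  ultimately show ?thesis
    by (intro that[of d]) (auto simp: R_Suc lam_side_of crosses_def Let_def)
qed

lemma no_crossing_step:
  assumes "\<not> crossing t a"
  obtains w where "pl (Suc t) a = accessed_place t a" "me (Suc t) a = (computed_mem t a)\<lparr>wait := w\<rparr>"
    "\<forall>p. accessed_place t a = OnPort p \<longrightarrow> 0 < w \<and> missing adv t = Some (edge_at n p)"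
proof (cases "accessed_place t a")
  case (InNode v)
  then show ?thesis by (intro that[of 0]) (simp_all add: R_Suc)
next
  case (OnPort p)
  with assms show ?thesis
    by (intro that[of "if pl t a = OnPort p then wait (computed_mem t a) + 1 else 1"])
       (auto simp: R_Suc crossing_def crosses_def)
qed

lemma well_placed: "well_placed t a"
proof (induction t arbitrary: a)
  case 0
  show ?case using start by (simp add: well_placed_def)
next
  case (Suc t)
  note W = Suc[of a] Suc[of "other a"]
  have "nd t a < n" using W by (simp add: well_placed_def)
  show ?case
  proof (cases "crossing t a")
    case True
    then show ?thesis
      using far_end_less
      by (rule_tac well_placed_crossing_step[OF W True]) (simp add: well_placed_def)
  next
    case False
    then obtain w where w: "pl (Suc t) a = accessed_place t a" "me (Suc t) a = (computed_mem t a)\<lparr>wait := w\<rparr>"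
      "\<forall>p. accessed_place t a = OnPort p \<longrightarrow> 0 < w \<and> missing adv t = Some (edge_at n p)"
      by (rule no_crossing_step) blast
    from well_placed_accessed_place_shape[OF W] show ?thesis
    proof
      assume "accessed_place t a = InNode (nd t a)"
      with w(1) \<open>nd t a < n\<close> show ?thesis by (simp add: well_placed_def)
    next
      assume "\<exists>d. accessed_place t a = OnPort (nd t a, side_of d) \<and> explore_dir (control (computed_mem t a)) = Some d \<and>
        Tnodes (computed_mem t a) < N"
      with w \<open>nd t a < n\<close> show ?thesis
        by (auto simp: well_placed_def Tnodes_def)
    qed
  qed
qed

lemmas computed_mem_cases = well_placed_computed_mem_cases[OF well_placed well_placed]
lemmas computed_mem_simps = well_placed_computed_mem_simps[OF well_placed well_placed]
lemmas crossing_step = well_placed_crossing_step[OF well_placed well_placed]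
lemmas accessed_place_shape = well_placed_accessed_place_shape[OF well_placed well_placed]
lemmas accessed_place_eq = well_placed_accessed_place_eq[OF well_placed]

lemma nd_less: "nd t a < n"
  using well_placed by (simp add: well_placed_def)

text \<open>Mutual exclusion survives a round: only unoccupied ports are gained,
  \<open>favoured\<close> breaks ties, and a crossing ends inside a node.\<close>

lemma not_same_port: "pl t a = OnPort p \<Longrightarrow> pl t (other a) \<noteq> OnPort p"
proof (induction t arbitrary: a p)
  case (Suc t)
  have D: "accessed_place t b = OnPort q" if "pl (Suc t) b = OnPort q" for b q
  proof (cases "crossing t b")
    case True
    then show ?thesis by (rule crossing_step) (use that in simp)
  next
    case False
    then show ?thesis by (rule no_crossing_step) (use that in simp)
  qed
  show ?case
  proof
    assume O: "pl (Suc t) (other a) = OnPort p"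
    have A: "accessed_place t a = OnPort p" "accessed_place t (other a) = OnPort p"
      using D O Suc.prems by blast+
    have "pl t a = OnPort p \<longrightarrow> pl t (other a) \<noteq> OnPort p" using Suc.IH by blast
    with A show False
      using other_ne[of a]
      by (auto simp: accessed_place_def accessed_def other_other split: option.splits if_splits)
  qed
qed simp

lemma crossing_simps:
  assumes "crossing t a"
  shows "control (me (Suc t) a) = control (computed_mem t a)"
    "leftSteps (me (Suc t) a) = leftSteps (computed_mem t a)"
    "rightSteps (me (Suc t) a) = rightSteps (computed_mem t a)"
    "Esteps (me (Suc t) a) = Esteps (computed_mem t a) + 1"
    "disp (me (Suc t) a) = disp (me t a) + step_towards (the (explore_dir (control (computed_mem t a))))"
    "seen (me (Suc t) a) = insert (disp (me (Suc t) a)) (seen (me t a))"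
    "\<exists>v. pl (Suc t) a = InNode v"
  by (rule crossing_step[OF assms]; simp add: computed_mem_simps)+

lemma no_crossing_simps:
  assumes "\<not> crossing t a"
  shows "control (me (Suc t) a) = control (computed_mem t a)"
    "leftSteps (me (Suc t) a) = leftSteps (computed_mem t a)"
    "rightSteps (me (Suc t) a) = rightSteps (computed_mem t a)"
    "Esteps (me (Suc t) a) = Esteps (computed_mem t a)"
    "disp (me (Suc t) a) = disp (me t a)"
    "seen (me (Suc t) a) = seen (me t a)"
    "pl (Suc t) a = accessed_place t a"
    "nd (Suc t) a = nd t a"
proof -
  obtain w where w: "pl (Suc t) a = accessed_place t a" "me (Suc t) a = (computed_mem t a)\<lparr>wait := w\<rparr>"
    by (rule no_crossing_step[OF assms])
  then show "control (me (Suc t) a) = control (computed_mem t a)"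
    "leftSteps (me (Suc t) a) = leftSteps (computed_mem t a)"
    "rightSteps (me (Suc t) a) = rightSteps (computed_mem t a)"
    "Esteps (me (Suc t) a) = Esteps (computed_mem t a)"
    "disp (me (Suc t) a) = disp (me t a)"
    "seen (me (Suc t) a) = seen (me t a)"
    "pl (Suc t) a = accessed_place t a"
    by (simp_all add: computed_mem_simps)
  show "nd (Suc t) a = nd t a"
    using accessed_place_shape[of t a] w(1) by auto
qed

section \<open>Displacements, visited nodes and exploration\<close>

lemma position: "[int (nd t a) = int (start a) + sign * disp (me t a)] (mod int n)"
proof (induction t)
  case 0
  then show ?case by (simp add: initial_memory_def)
next
  case (Suc t)
  show ?case
  proof (cases "crossing t a")
    case True
    then obtain d where d: "pl (Suc t) a = InNode (far_end n (nd t a, side_of d))"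
      "disp (me (Suc t) a) = disp (me t a) + step_towards d"
      by (rule crossing_step) (simp add: computed_mem_simps)
    have "[int (nd t a) + sign * step_towards d =
        int (start a) + sign * disp (me t a) + sign * step_towards d] (mod int n)"
      using Suc by (rule cong_add) simp
    from cong_trans[OF far_end_cong this] d show ?thesis
      by (simp add: distrib_left add.assoc)
  next
    case False
    with Suc show ?thesis by (simp only: no_crossing_simps(5,8)[OF False])
  qed
qed

text \<open>Indexed by integers rather than nodes, so that positions in the universal cover can be
  inserted without reduction.\<close>

definition visited :: "nat \<Rightarrow> int \<Rightarrow> bool" where
  "visited t z \<longleftrightarrow> (\<exists>s\<le>t. \<exists>a. [int (nd s a) = z] (mod int n))"

lemma visited_mono: "visited s z \<Longrightarrow> s \<le> t \<Longrightarrow> visited t z"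
  unfolding visited_def by (meson order_trans)

lemma visited_now: "visited t (int (start a) + sign * disp (me t a))"
  unfolding visited_def using position by blast

lemma visited_cong: "visited t z \<Longrightarrow> [z = z'] (mod int n) \<Longrightarrow> visited t z'"
  unfolding visited_def by (meson cong_trans)

lemma explored_mono: "explored_by n R s \<Longrightarrow> s \<le> t \<Longrightarrow> explored_by n R t"
  unfolding explored_by_def by (meson order_trans)

text \<open>\<open>n\<close> consecutive integers meet every residue class, and multiplication by
  \<open>sign\<close> permutes the classes.\<close>

lemma explored_if_interval:
  assumes "\<And>z. x \<le> z \<Longrightarrow> z \<le> y \<Longrightarrow> visited t (q + sign * z)" "int n - 1 \<le> y - x"
  shows "explored_by n R t"
  unfolding explored_by_def
proof (intro allI impI)
  fix v assume v: "v < n"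
  \<comment> \<open>The representative in \<open>{x..x + n - 1}\<close> of the class of
    \<open>sign * (v - q)\<close>; \<open>sign\<close> is its own inverse.\<close>
  define z where "z = x + (sign * (int v - q) - x) mod int n"
  have "[z = x + (sign * (int v - q) - x)] (mod int n)"
    unfolding z_def by (intro cong_add) (auto simp: cong_def)
  then have "[sign * z = sign * (sign * (int v - q))] (mod int n)"
    by (intro cong_mult) auto
  moreover have "sign * (sign * (int v - q)) = int v - q"
    using sign_cases by auto
  ultimately have "[q + sign * z = q + (int v - q)] (mod int n)"
    by (intro cong_add) auto
  then have c: "[q + sign * z = int v] (mod int n)" by simp
  have "0 \<le> (sign * (int v - q) - x) mod int n" "(sign * (int v - q) - x) mod int n < int n"
    using v by simp_all
  then have "visited t (q + sign * z)"
    using assms by (simp add: z_def)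
  with c have "visited t (int v)" using visited_cong by blast
  then obtain s a where "s \<le> t" "[int (nd s a) = int v] (mod int n)"
    unfolding visited_def by blast
  moreover from this have "nd s a = v"
    using v nd_less[of s a] by (simp add: cong_int_iff cong_less_modulus_unique_nat)
  ultimately show "\<exists>s\<le>t. \<exists>a. nd s a = v" by blast
qed

section \<open>Cost and exploration along a run\<close>

lemma moves_Suc: "moves (Suc t) a = moves t a + of_bool (crossing t a)"
  by (simp add: moves_def)

lemma cost_invariant: "cost_invariant N (me t a) (moves t a)"
proof (induction t)
  case 0
  show ?case
    using cost_invariant_initial[of N] n_ge_2 n_le_N by (simp add: moves_def)
next
  case (Suc t)
  have C: "cost_invariant N (computed_mem t a) (moves t a)"
  proof (cases rule: computed_mem_cases[where t = t and a = a, case_names stay enough catch blocked])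
    case stay
    with Suc show ?thesis by simp
  next
    case enough
    with Suc show ?thesis by (simp add: cost_invariant_Terminate)
  next
    case catch
    with Suc show ?thesis by (simp add: cost_invariant_Bounce del: enter.simps)
  next
    case blocked
    with Suc show ?thesis by (simp add: cost_invariant_Reverse del: enter.simps)
  qed
  show ?case
  proof (cases "crossing t a")
    case True
    then show ?thesis
      by (rule crossing_step) (use C True cost_invariant_move in \<open>simp add: moves_Suc\<close>)
  next
    case False
    then show ?thesis
      by (rule no_crossing_step) (use C False in \<open>simp add: moves_Suc cost_invariant_wait\<close>)
  qed
qed

lemma seen_visited:
  "z \<in> seen (me t a) \<Longrightarrow> visited t (int (start a) + sign * z)"
proof (induction t)
  case 0
  then show ?case using visited_now[of 0 a] by (simp add: initial_memory_def)
next
  case (Suc t)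
  have "z \<in> seen (me t a) \<or> z = disp (me (Suc t) a)"
    using Suc.prems crossing_simps(6)[of t a] no_crossing_simps(6)[of t a] by auto
  then show ?case
    using Suc.IH visited_mono[of t _ "Suc t"] visited_now[of "Suc t" a] by auto
qed

text \<open>By the cost invariant \<open>seen\<close> is an interval; with at least
  \<open>N \<ge> n\<close> consecutive displacements it covers the ring.\<close>

lemma explored_if_Tnodes:
  assumes "N \<le> Tnodes (me t a)"
  shows "explored_by n R t"
proof -
  obtain lo hi where S: "seen (me t a) = {lo..hi}" "lo \<le> 0" "0 \<le> hi"
    using cost_invariant[of t a] unfolding cost_invariant_def by blast
  show ?thesis
  proof (rule explored_if_interval)
    show "visited t (int (start a) + sign * z)" if "lo \<le> z" "z \<le> hi" for z
      using that S seen_visited by simp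
    show "int n - 1 \<le> hi - lo"
      using assms S n_le_N by (simp add: Tnodes_def)
  qed
qed

lemma moves_bound: "moves t a \<le> 2 * N * N + 2 * N"
proof -
  have "int (moves t a) \<le> int (2 * N * N + 2 * N)"
    using cost_invariant_bound[OF cost_invariant] by simp
  then show ?thesis by linarith
qed

lemma traversals_eq:
  "traversals n N lam start adv T = moves T Agent1 + moves T Agent2"
proof -
  have "card {a. crossing t a} = of_bool (crossing t Agent1) + of_bool (crossing t Agent2)" for t
  proof -
    have "{a. crossing t a} = (if crossing t Agent1 then {Agent1} else {}) \<union> (if crossing t Agent2 then {Agent2} else {})"
      by auto (metis agent.exhaust)+
    then show ?thesis by simp
  qed
  then show ?thesis
    by (simp add: traversals_def moves_def sum.distrib crossing_def accessed_place_def)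
qed

section \<open>Safety\<close>

lemma left_moving_iff: "left_moving s \<longleftrightarrow> explore_dir s = Some Left"
  by (cases s) (auto simp: left_moving_def)

lemma Bounce_iff: "s = Bounce \<longleftrightarrow> explore_dir s = Some Right"
  by (cases s) auto

lemma on_port:
  "pl t a = OnPort p \<Longrightarrow>
    \<exists>d. explore_dir (control (me t a)) = Some d \<and> p = (nd t a, side_of d)"
  using well_placed[of t a] unfolding well_placed_def by blast

text \<open>Before exploration \<open>Tnodes\<close> is below \<open>N\<close>, so termination by
  counting drops out.\<close>

lemma round_cases:
  assumes "\<not> explored_by n R t"
  obtains (stay) "computed_mem t a = me t a"
      "goal_dir t a = (if a \<in> active adv t then explore_dir (control (me t a)) else None)"
    | (catch) "left_moving (control (me t a))" "\<exists>v. pl t a = InNode v"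
        "pl t (other a) = OnPort (nd t a, side_of Left)" "computed_mem t a = enter Bounce (me t a)"
    | (blocked) "control (me t a) = Bounce" "pl t a = OnPort (nd t a, side_of Right)"
        "computed_mem t a = enter Reverse (me t a)"
  using explored_if_Tnodes[of t a] assms
  by (cases rule: computed_mem_cases[where t = t and a = a]) auto

text \<open>Consequently \<open>disp + Esteps\<close>, the place where the leftward walk began, is
  constant.\<close>

lemma left_stay:
  assumes "left_moving (control (me t a))" "computed_mem t a = me t a"
  shows "control (me (Suc t) a) = control (me t a)"
    "disp (me (Suc t) a) = disp (me t a) - of_bool (crossing t a)"
    "Esteps (me (Suc t) a) = Esteps (me t a) + of_bool (crossing t a)"
    "rightSteps (me (Suc t) a) = rightSteps (me t a)"
  using assms crossing_simps[of t a] no_crossing_simps[of t a]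
  by (cases "crossing t a"; simp add: left_moving_iff)+

text \<open>The hypothesis concerns the state after Compute, so that the round of the catch and the
  later rounds in Bounce are treated alike. The bounce place \<open>disp - Esteps\<close> stays
  fixed.\<close>

lemma Bounce_step:
  assumes "control (computed_mem t a) = Bounce"
  shows "control (me (Suc t) a) = Bounce"
    "disp (me (Suc t) a) = disp (me t a) + of_bool (crossing t a)"
    "Esteps (me (Suc t) a) = Esteps (computed_mem t a) + of_bool (crossing t a)"
    "\<not> (\<exists>v. pl (Suc t) a = InNode v) \<Longrightarrow>
      missing adv t = Some (edge_at n (nd t a, side_of Right))"
proof -
  show "control (me (Suc t) a) = Bounce"
    "disp (me (Suc t) a) = disp (me t a) + of_bool (crossing t a)"
    "Esteps (me (Suc t) a) = Esteps (computed_mem t a) + of_bool (crossing t a)"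
    using assms crossing_simps[of t a] no_crossing_simps[of t a] by (cases "crossing t a"; simp)+
  assume N: "\<not> (\<exists>v. pl (Suc t) a = InNode v)"
  then have C: "\<not> crossing t a" using crossing_simps(7) by blast
  then show "missing adv t = Some (edge_at n (nd t a, side_of Right))"
    using N accessed_place_shape[of t a] assms by (auto elim!: no_crossing_step)
qed

text \<open>The port is the one the state asks for, so neither sleep nor activation gives it up;
  then only a missing edge can prevent a crossing.\<close>

lemma on_port_stay:
  assumes "pl t a = OnPort (nd t a, side_of d)" "computed_mem t a = me t a"
    "goal_dir t a = (if a \<in> active adv t then explore_dir (control (me t a)) else None)"
    "\<not> crossing t a"
  shows "pl (Suc t) a = pl t a" "missing adv t = Some (edge_at n (nd t a, side_of d))"
proof -
  have "explore_dir (control (me t a)) = Some d"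
    using on_port[OF assms(1)] side_of_inj by auto
  then have "accessed_place t a = pl t a"
    using assms by (simp add: accessed_place_eq)
  with no_crossing_step[OF assms(4)] assms(1)
  show "pl (Suc t) a = pl t a" "missing adv t = Some (edge_at n (nd t a, side_of d))"
    by metis+
qed

lemma Init_rightSteps: "control (me t a) = Init \<Longrightarrow> rightSteps (me t a) = None"
  using cost_invariant[of t a] by (auto simp: cost_invariant_def)

text \<open>
  \<open>disp + off\<close> lifts the positions of both agents to the universal cover of the ring in such a way that
  they coincide when an agent catches the other for the first time. As long as the ring has not been
  explored, agents meet in the ring only if they meet in the cover. The place of the last bounce is
  \<open>X a - Esteps\<close> in state Bounce, and \<open>X a + Esteps - rightSteps\<close> in state Reverse.
\<close>

definition linked :: "int \<Rightarrow> (agent \<Rightarrow> int) \<Rightarrow> nat \<Rightarrow> bool" where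
  "linked q off t \<longleftrightarrow> (let X = (\<lambda>a. disp (me t a) + off a) in
     (\<forall>a. [int (start a) = q + sign * off a] (mod int n)) \<and>
     (\<forall>a z. X a \<le> z \<longrightarrow> z \<le> X (other a) \<longrightarrow> visited t (q + sign * z)) \<and>
     (\<forall>a. control (me t a) \<noteq> Terminate) \<and>
     (\<forall>a. control (me t a) = Bounce \<longrightarrow> left_moving (control (me t (other a))) \<and>
        (X (other a) < X a - int (Esteps (me t a)) \<or>
         X (other a) = X a - int (Esteps (me t a)) \<and>
           pl t (other a) = OnPort (nd t (other a), side_of Left) \<and> (\<exists>v. pl t a = InNode v))) \<and>
     (\<forall>a. control (me t a) = Reverse \<longrightarrow> (\<exists>r. rightSteps (me t a) = Some r \<and>
        (r < Esteps (me t a) \<or>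
         X (other a) < X a + int (Esteps (me t a)) - int r \<and>
           left_moving (control (me t (other a)))))))"

lemma lifted_position:
  assumes "[int (start a) = q + sign * off] (mod int n)"
  shows "[int (nd t a) = q + sign * (disp (me t a) + off)] (mod int n)"
proof -
  have "[int (start a) + sign * disp (me t a) = q + sign * off + sign * disp (me t a)] (mod int n)"
    using assms by (rule cong_add) simp
  from cong_trans[OF position this] show ?thesis
    by (simp add: algebra_simps)
qed

lemma sign_cancel: "[q + sign * x = q + sign * y] (mod int n) \<Longrightarrow> int n dvd x - y"
  using sign_cases by (auto simp: cong_iff_dvd_diff dvd_diff_commute)

section \<open>Preservation of the lift while the ring is unexplored\<close>

context
  fixes q off t
  assumes linked: "linked q off t" and unexplored: "\<not> explored_by n R t"
begin

private definition X where "X a = disp (me t a) + off a"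

lemma linked_start: "[int (start a) = q + sign * off a] (mod int n)"
  and linked_visited: "X a \<le> z \<Longrightarrow> z \<le> X (other a) \<Longrightarrow> visited t (q + sign * z)"
  and linked_Terminate: "control (me t a) \<noteq> Terminate"
  and linked_Bounce: "control (me t a) = Bounce \<Longrightarrow> left_moving (control (me t (other a))) \<and>
        (X (other a) < X a - int (Esteps (me t a)) \<or>
         X (other a) = X a - int (Esteps (me t a)) \<and>
           pl t (other a) = OnPort (nd t (other a), side_of Left) \<and> (\<exists>v. pl t a = InNode v))"
  and linked_Reverse: "control (me t a) = Reverse \<Longrightarrow> \<exists>r. rightSteps (me t a) = Some r \<and>
        (r < Esteps (me t a) \<or>
         X (other a) < X a + int (Esteps (me t a)) - int r \<and>
           left_moving (control (me t (other a))))"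
  using linked unfolding linked_def Let_def X_def by blast+

text \<open>All points between the two lifted positions have been visited; \<open>n\<close> of them
  would explore the ring.\<close>

lemma linked_gap: "X b - X a < int n - 1"
  using explored_if_interval[of "X a" "X b" t q] linked_visited[of a] unexplored agent_cases[of b a]
    n_ge_2
  by force

lemma linked_position: "[int (nd t a) = q + sign * X a] (mod int n)"
  unfolding X_def by (rule lifted_position[OF linked_start])

text \<open>Lifts of agents at one node differ by a multiple of \<open>n\<close>, and the gap is too
  small for a nonzero one.\<close>

lemma linked_meet:
  assumes "nd t a = nd t b"
  shows "X a = X b"
proof -
  have "[q + sign * X a = q + sign * X b] (mod int n)"
    using linked_position[of a] linked_position[of b] assms by (metis cong_sym cong_trans)
  then have "int n dvd X a - X b" by (rule sign_cancel)
  moreover have "\<bar>X a - X b\<bar> < \<bar>int n\<bar>"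
    using linked_gap[of a b] linked_gap[of b a] by linarith
  ultimately show ?thesis using dvd_imp_le_int[of "X a - X b" "int n"] by linarith
qed

text \<open>Only one edge is missing: if it blocks both agents, they have surrounded the ring.\<close>

lemma linked_not_both_blocked:
  assumes "X b \<le> X a" "missing adv t = Some (edge_at n (nd t a, side_of Right))"
    "missing adv t = Some (edge_at n (nd t b, side_of Left))"
  shows False
proof -
  have e: "[int (nd t a) + sign = int (nd t b)] (mod int n)"
    using assms by (intro edge_at_opposite) simp
  have "[int (nd t a) + sign = q + sign * X a + sign] (mod int n)"
    by (rule cong_add[OF linked_position]) simp
  then have "[q + sign * (X a + 1) = int (nd t a) + sign] (mod int n)"
    by (simp add: algebra_simps cong_sym)
  from cong_trans[OF cong_trans[OF this e] linked_position]
  have "int n dvd X a + 1 - X b" by (rule sign_cancel)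
  \<comment> \<open>The difference is positive, so divisibility makes it at least \<open>n\<close>:
    the agents stand at the ends of a visited stretch of at least \<open>n\<close> points.\<close>
  then have "int n \<le> X a + 1 - X b"
    using assms(1) by (intro zdvd_imp_le) auto
  with linked_gap[of a b] show False by simp
qed

text \<open>At a meeting \<open>X a = X (other a)\<close>, so either alternative recorded for
  Reverse yields \<open>r < Esteps\<close> and the test for termination fails. In Init,
  \<open>rightSteps\<close> is still \<open>None\<close>.\<close>

lemma linked_catch:
  assumes "left_moving (control (me t a))" "computed_mem t a = enter Bounce (me t a)"
    "nd t a = nd t (other a)"
  shows "control (computed_mem t a) = Bounce" "Esteps (computed_mem t a) = 0"
proof -
  have "\<not> (\<exists>r. rightSteps (me t a) = Some r \<and> Esteps (me t a) \<le> r)"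
  proof (cases "control (me t a) = Reverse")
    case True
    then show ?thesis
      using linked_Reverse[OF True] linked_meet[OF assms(3)] by auto
  next
    case False
    with assms(1) have "control (me t a) = Init" by (simp add: left_moving_def)
    then show ?thesis by (simp add: Init_rightSteps)
  qed
  then have "control (computed_mem t a) = Bounce \<and> Esteps (computed_mem t a) = 0"
    unfolding assms(2) by (auto simp: Let_def split: option.splits)
  then show "control (computed_mem t a) = Bounce" "Esteps (computed_mem t a) = 0" by auto
qed

lemma linked_computed_mem_Terminate: "control (computed_mem t a) \<noteq> Terminate"
  using unexplored
proof (cases rule: round_cases[where a = a])
  case stay
  then show ?thesis using linked_Terminate by simp
next
  case catch
  moreover from this have "nd t a = nd t (other a)" by simp
  ultimately show ?thesis using linked_catch by simp
next
  case blocked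
  then show ?thesis by simp
qed

lemma linked_step:
  assumes "\<not> explored_by n R (Suc t)"
  shows "linked q off (Suc t)"
proof -
  define Y where "Y a = disp (me (Suc t) a) + off a" for a
  have Y_near: "Y a = X a \<or> Y a = X a + 1 \<or> Y a = X a - 1" for a
  proof (cases "crossing t a")
    case True
    then show ?thesis
      using crossing_simps(5)[OF True] unfolding X_def Y_def
      by (cases "the (explore_dir (control (computed_mem t a)))") auto
  next
    case False
    then show ?thesis using no_crossing_simps(5)[OF False] by (simp add: X_def Y_def)
  qed
  have visited: "visited (Suc t) (q + sign * z)" if "Y a \<le> z" "z \<le> Y (other a)" for a z
  proof -
    have now: "visited (Suc t) (q + sign * Y b)" for b
      using lifted_position[OF linked_start, of "Suc t" b] unfolding visited_def Y_def by blast
    \<comment> \<open>Positions change by at most one, so only the ends of the stretch can be new,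
      and agents stand there now.\<close>
    have "z = Y a \<or> z = Y (other a) \<or> X a \<le> z \<and> z \<le> X (other a)"
      using that Y_near[of a] Y_near[of "other a"] by linarith
    then consider "z = Y a" | "z = Y (other a)" | "X a \<le> z" "z \<le> X (other a)" by blast
    then show ?thesis
    proof cases
      case 3
      then show ?thesis using linked_visited visited_mono[of t _ "Suc t"] by simp
    qed (use now in simp_all)
  qed
  have T: "control (me (Suc t) a) \<noteq> Terminate" for a
    using linked_computed_mem_Terminate[of a] crossing_simps(1)[of t a] no_crossing_simps(1)[of t a] by (cases "crossing t a") auto
  \<comment> \<open>Before exploration a left-moving agent changes state only by a catch, which
    needs the first agent on the left port of its node.\<close>
  have other_stays: "computed_mem t (other a) = me t (other a) \<and>
      goal_dir t (other a) = (if other a \<in> active adv t then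
        explore_dir (control (me t (other a))) else None)"
    if "left_moving (control (me t (other a)))" "pl t a \<noteq> OnPort (nd t (other a), side_of Left)"
    for a
    using unexplored
    by (cases rule: round_cases[where a = "other a"])
       (use that in \<open>auto simp: other_other left_moving_def\<close>)
  have Bounce_not_left: "pl t a \<noteq> OnPort (v, side_of Left)" if "control (me t a) = Bounce" for a v
    using on_port[of t a "(v, side_of Left)"] that side_of_inj by auto
  \<comment> \<open>Common core of the catch and of the rounds in Bounce. The caught agent only
    stays or moves left of the fixed bounce place; equality means that it has not left its
    port.\<close>
  have bouncing: "left_moving (control (me (Suc t) (other a))) \<and>
        (Y (other a) < Y a - int (Esteps (me (Suc t) a)) \<or>
         Y (other a) = Y a - int (Esteps (me (Suc t) a)) \<and>
           pl (Suc t) (other a) = OnPort (nd (Suc t) (other a), side_of Left) \<and>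
           (\<exists>v. pl (Suc t) a = InNode v))"
    if B: "control (computed_mem t a) = Bounce" and L: "left_moving (control (me t (other a)))"
      and stay: "computed_mem t (other a) = me t (other a)"
        "goal_dir t (other a) = (if other a \<in> active adv t then
          explore_dir (control (me t (other a))) else None)"
      and D: "X (other a) < X a - int (Esteps (computed_mem t a)) \<or>
         X (other a) = X a - int (Esteps (computed_mem t a)) \<and>
           pl t (other a) = OnPort (nd t (other a), side_of Left)" for a
  proof (cases "X (other a) < X a - int (Esteps (computed_mem t a)) \<or> crossing t (other a)")
    case True
    then show ?thesis
      using left_stay[OF L stay(1)] Bounce_step[OF B] L D unfolding X_def Y_def
      by (cases "crossing t a"; cases "crossing t (other a)") auto
  next
    case False
    then have nc: "\<not> crossing t (other a)" by simp
    have p: "pl t (other a) = OnPort (nd t (other a), side_of Left)" using D False by simp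
    have e: "X (other a) = X a - int (Esteps (computed_mem t a))" using D False by simp
    note s = on_port_stay[OF p stay nc]
    \<comment> \<open>The missing edge already holds the caught agent on its left port, so it cannot
      also hold the bouncing one.\<close>
    have "\<exists>v. pl (Suc t) a = InNode v"
    proof (rule ccontr)
      assume "\<not> (\<exists>v. pl (Suc t) a = InNode v)"
      from Bounce_step(4)[OF B this] s(2) e show False
        by (intro linked_not_both_blocked[of "other a" a]) auto
    qed
    moreover have "Y (other a) = Y a - int (Esteps (me (Suc t) a))"
      using left_stay[OF L stay(1)] Bounce_step[OF B] e nc unfolding X_def Y_def by simp
    moreover have "pl (Suc t) (other a) = OnPort (nd (Suc t) (other a), side_of Left)"
      using s(1) p by simp
    ultimately show ?thesis
      using left_stay(1)[OF L stay(1)] L by simp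
  qed
  have "(control (me (Suc t) a) = Bounce \<longrightarrow> left_moving (control (me (Suc t) (other a))) \<and>
        (Y (other a) < Y a - int (Esteps (me (Suc t) a)) \<or>
         Y (other a) = Y a - int (Esteps (me (Suc t) a)) \<and>
           pl (Suc t) (other a) = OnPort (nd (Suc t) (other a), side_of Left) \<and>
           (\<exists>v. pl (Suc t) a = InNode v))) \<and>
     (control (me (Suc t) a) = Reverse \<longrightarrow> (\<exists>r. rightSteps (me (Suc t) a) = Some r \<and>
        (r < Esteps (me (Suc t) a) \<or>
         Y (other a) < Y a + int (Esteps (me (Suc t) a)) - int r \<and>
           left_moving (control (me (Suc t) (other a))))))" for a
    using unexplored
  proof (cases rule: round_cases[where a = a])
    case catch
    then have same: "nd t a = nd t (other a)" by simp
    note c = linked_catch[OF catch(1,4) same]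
    have L: "left_moving (control (me t (other a)))"
      using on_port[OF catch(3)] side_of_inj by (auto simp: left_moving_iff)
    have "pl t a \<noteq> OnPort p" for p using catch(2) by auto
    with other_stays[OF L] have s: "computed_mem t (other a) = me t (other a)"
        "goal_dir t (other a) = (if other a \<in> active adv t then
          explore_dir (control (me t (other a))) else None)" by auto
    have "X (other a) = X a - int (Esteps (computed_mem t a)) \<and>
        pl t (other a) = OnPort (nd t (other a), side_of Left)"
      using linked_meet[OF same] c(2) catch(3) by simp
    with bouncing[OF c(1) L s] show ?thesis
      using Bounce_step(1)[OF c(1)] by simp
  next
    case blocked
    \<comment> \<open>An agent about to reverse is on a port, which excludes the equality
      alternative: the caught agent is already strictly left of the bounce place.\<close>
    have L: "left_moving (control (me t (other a)))"
      and lt: "X (other a) < X a - int (Esteps (me t a))"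
      using linked_Bounce[OF blocked(1)] blocked(2) by auto
    have s: "computed_mem t (other a) = me t (other a)"
      using other_stays[OF L] Bounce_not_left[OF blocked(1)] by blast
    have "control (computed_mem t a) = Reverse" "rightSteps (computed_mem t a) = Some (Esteps (me t a))"
      "Esteps (computed_mem t a) = 0"
      using blocked(3) by simp_all
    then have "control (me (Suc t) a) = Reverse"
      "rightSteps (me (Suc t) a) = Some (Esteps (me t a))"
      "Y a + int (Esteps (me (Suc t) a)) = X a"
      using crossing_simps[of t a] no_crossing_simps[of t a] unfolding X_def Y_def by (cases "crossing t a"; simp)+
    moreover have "Y (other a) \<le> X (other a)" "left_moving (control (me (Suc t) (other a)))"
      using left_stay[OF L s] L unfolding X_def Y_def by simp_all
    ultimately show ?thesis using lt by simp
  next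
    case stay
    show ?thesis
    proof (cases "control (me t a)" rule: control_cases)
      case 1
      note l = left_stay[OF 1 stay(1)]
      have "\<exists>r. rightSteps (me (Suc t) a) = Some r \<and>
        (r < Esteps (me (Suc t) a) \<or>
         Y (other a) < Y a + int (Esteps (me (Suc t) a)) - int r \<and>
           left_moving (control (me (Suc t) (other a))))"
        if Rev: "control (me t a) = Reverse"
      proof -
        obtain r where r: "rightSteps (me t a) = Some r" "r < Esteps (me t a) \<or>
          X (other a) < X a + int (Esteps (me t a)) - int r \<and> left_moving (control (me t (other a)))"
          using linked_Reverse[OF Rev] by blast
        show ?thesis
        proof (cases "r < Esteps (me t a)")
          case True
          with r(1) l show ?thesis by simp
        next
          case False
          with r(2) have L: "left_moving (control (me t (other a)))"
            and lt: "X (other a) < X a + int (Esteps (me t a)) - int r" by auto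
          \<comment> \<open>While \<open>Esteps \<le> r\<close> the agent is not left of its last
            bounce place, whereas the other is strictly left of it. So they do not meet, and the
            other cannot catch and keeps moving left.\<close>
          have "nd t a \<noteq> nd t (other a)"
            using linked_meet[of a "other a"] lt False by auto
          then have "pl t a \<noteq> OnPort (nd t (other a), side_of Left)" by (cases "pl t a") auto
          with other_stays[OF L] have s: "computed_mem t (other a) = me t (other a)" by blast
          have "Y (other a) \<le> X (other a)" "left_moving (control (me (Suc t) (other a)))"
            using left_stay[OF L s] L unfolding X_def Y_def by simp_all
          moreover have "Y a + int (Esteps (me (Suc t) a)) = X a + int (Esteps (me t a))"
            using l unfolding X_def Y_def by simp
          ultimately show ?thesis using r(1) l(4) lt by simp
        qed
      qed
      with 1 l(1) show ?thesis by (auto simp: left_moving_def)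
    next
      case 2
      then have c: "control (computed_mem t a) = Bounce" "Esteps (computed_mem t a) = Esteps (me t a)"
        using stay by simp_all
      have L: "left_moving (control (me t (other a)))" using linked_Bounce[OF 2] by blast
      have s: "computed_mem t (other a) = me t (other a)"
        "goal_dir t (other a) = (if other a \<in> active adv t then
          explore_dir (control (me t (other a))) else None)"
        using other_stays[OF L] Bounce_not_left[OF 2] by blast+
      from bouncing[OF c(1) L s] linked_Bounce[OF 2] c(2) Bounce_step(1)[OF c(1)]
      show ?thesis by auto
    next
      case 3
      then show ?thesis using linked_Terminate by blast
    qed
  qed
  with linked_start visited T show ?thesis
    unfolding linked_def Let_def Y_def by blast
qed

end

text \<open>The offsets cancel the displacements, so both lifted positions are 0 over the common
  node; the clauses on Bounce and Reverse are vacuous.\<close>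

lemma linked_if_meet:
  assumes "\<And>a. control (me t a) = Init" "nd t a = nd t (other a)"
  shows "linked (int (nd t a)) (\<lambda>b. - disp (me t b)) t"
proof -
  have E: "nd t b = nd t a" for b using assms(2) agent_cases[of b a] by auto
  have "[int (start b) = int (nd t a) + sign * - disp (me t b)] (mod int n)" for b
  proof -
    have "[int (nd t a) + - (sign * disp (me t b)) =
        int (start b) + sign * disp (me t b) + - (sign * disp (me t b))] (mod int n)"
      using position[of t b] E[of b] by (intro cong_add) auto
    then show ?thesis by (simp add: cong_sym)
  qed
  moreover have "visited t (int (nd t a))"
    unfolding visited_def by (intro exI[of _ t] conjI exI[of _ a]) simp_all
  ultimately show ?thesis
    using assms(1) unfolding linked_def by auto
qed

text \<open>A shared node in state Init already provides the lift. Agents in Init that are not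
  linked are therefore at distinct nodes, where no catch is possible, and remain in Init.\<close>

lemma safety:
  "explored_by n R t \<or> (\<forall>a. control (me t a) = Init) \<or> (\<exists>q off. linked q off t)"
proof (induction t)
  case 0
  show ?case by (simp add: initial_memory_def)
next
  case (Suc t)
  show ?case
  proof (cases "explored_by n R (Suc t)")
    case False
    then have U: "\<not> explored_by n R t" using explored_mono by (meson le_SucI order_refl)
    show ?thesis
    proof (cases "\<exists>q off. linked q off t")
      case True
      then show ?thesis using linked_step[OF _ U False] by blast
    next
      case NL: False
      with Suc U have I: "\<And>a. control (me t a) = Init" by blast
      have apart: "nd t a \<noteq> nd t (other a)" for a
        using linked_if_meet[OF I] NL by blast
      have "computed_mem t a = me t a" for a
        using U by (cases rule: round_cases[where a = a]) (use I apart[of a] in auto)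
      then have "control (me (Suc t) a) = Init" for a
        using left_stay(1)[of t a] I by (simp add: left_moving_def)
      then show ?thesis by blast
    qed
  qed simp
qed

text \<open>Before exploration a linked agent never terminates; an agent that is not linked is in
  Init, where a bounce finds \<open>rightSteps\<close> undefined.\<close>

lemma explored_when_terminating:
  assumes "control (me t a) \<noteq> Terminate" "control (me (Suc t) a) = Terminate"
  shows "explored_by n R t"
proof (rule ccontr)
  assume U: "\<not> explored_by n R t"
  have C: "control (computed_mem t a) = Terminate"
    using assms(2) crossing_simps(1)[of t a] no_crossing_simps(1)[of t a] by (cases "crossing t a") auto
  show False
  proof (cases "\<exists>q off. linked q off t")
    case True
    then show False using linked_computed_mem_Terminate[OF _ U] C by blast
  next
    case False
    with safety[of t] U have I: "control (me t a) = Init" by blast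
    show False
      using U
      by (cases rule: round_cases[where a = a])
         (use C assms(1) I Init_rightSteps[OF I] in \<open>auto simp: Let_def\<close>)
  qed
qed

text \<open>\<open>Terminate\<close> has no direction, so by \<open>well_placed\<close> the agent is
  not on a port and even passive transport cannot move it.\<close>

lemma terminated_stays:
  assumes "control (me t a) = Terminate"
  shows "control (me (Suc t) a) = Terminate" "pl (Suc t) a = pl t a"
proof -
  have G: "computed_mem t a = me t a \<and> goal_dir t a = None"
    by (cases rule: computed_mem_cases[where t = t and a = a]) (use assms in \<open>auto simp: left_moving_def\<close>)
  then have A: "accessed_place t a = pl t a" by (simp add: accessed_place_eq)
  obtain v where "pl t a = InNode v"
    using on_port[of t a] assms by (cases "pl t a") auto
  with A have "\<not> crossing t a" by (simp add: crossing_def crosses_def)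
  with no_crossing_simps[OF this] A G assms
  show "control (me (Suc t) a) = Terminate" "pl (Suc t) a = pl t a" by simp_all
qed

lemma terminated_forever:
  assumes "control (me t a) = Terminate" "t \<le> t'"
  shows "control (me t' a) = Terminate \<and> pl t' a = pl t a"
  using assms(2)
  by (induction t' rule: dec_induct) (use assms(1) terminated_stays in simp_all)

lemma explicitly_terminates:
  assumes "control (me T a) = Terminate"
  shows "explicitly_terminates n R a"
proof -
  define t where "t = (LEAST t. control (me t a) = Terminate)"
  have t: "control (me t a) = Terminate"
    unfolding t_def using assms by (rule LeastI)
  then obtain s where s: "t = Suc s"
    by (cases t) (auto simp: initial_memory_def)
  have ns: "control (me s a) \<noteq> Terminate"
    using not_less_Least[of s "\<lambda>t. control (me t a) = Terminate"] s unfolding t_def by auto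
  show ?thesis
    unfolding explicitly_terminates_def terminated_def
  proof (intro exI[of _ s] conjI allI impI)
    show "explored_by n R s"
      using ns t s explored_when_terminating by simp
    fix t' assume "s < t'"
    then show "control (me t' a) = Terminate" "pl t' a = pl (Suc s) a"
      using terminated_forever[of "Suc s" a t'] t s by auto
  qed (rule ns)
qed

section \<open>Liveness\<close>

text \<open>The delicate case is a catch in Reverse: from value 1, where
  \<open>Esteps \<le> r\<close>, it can only terminate; it leads to Bounce, of value 2, only from
  value 3.\<close>

lemma transitions_left_computed_mem: "computed_mem t a = me t a \<or> transitions_left (computed_mem t a) < transitions_left (me t a)"
  by (cases rule: computed_mem_cases[where t = t and a = a])
     (auto simp: transitions_left_def left_moving_def Let_def split: control.splits option.splits)

text \<open>All other cases of Compute change the control state, so unchanged memory singles out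
  \<open>stay\<close>.\<close>

lemma stay_facts:
  assumes "computed_mem t a = me t a"
  shows "goal_dir t a = (if a \<in> active adv t then explore_dir (control (me t a)) else None)"
    and "a \<in> active adv t \<Longrightarrow> left_moving (control (me t a)) \<Longrightarrow>
        \<not> ((\<exists>v. pl t a = InNode v) \<and> pl t (other a) = OnPort (nd t a, side_of Left))"
    and "a \<in> active adv t \<Longrightarrow> control (me t a) = Bounce \<Longrightarrow> (\<exists>v. pl t a = InNode v)"
proof -
  have "control (me t a) \<noteq> control (computed_mem t a)"
    if "left_moving (control (me t a))" "computed_mem t a = enter Bounce (me t a)"
    unfolding that(2) using that(1) by (auto simp: left_moving_def Let_def)
  with assms show "goal_dir t a = (if a \<in> active adv t then explore_dir (control (me t a)) else None)"
    "a \<in> active adv t \<Longrightarrow> left_moving (control (me t a)) \<Longrightarrow>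
        \<not> ((\<exists>v. pl t a = InNode v) \<and> pl t (other a) = OnPort (nd t a, side_of Left))"
    "a \<in> active adv t \<Longrightarrow> control (me t a) = Bounce \<Longrightarrow> (\<exists>v. pl t a = InNode v)"
    by (cases rule: computed_mem_cases[where t = t and a = a];
        force dest: arg_cong[where f = control] simp del: enter.simps(2))+
qed

lemma eventually_still:
  obtains T where "\<And>t a. T \<le> t \<Longrightarrow> \<not> crossing t a" "\<And>t a. T \<le> t \<Longrightarrow> computed_mem t a = me t a"
proof -
  let ?B = "2 * N * N + 2 * N"
  \<comment> \<open>The complement of the cost bound turns bounded growth into descent;
    \<open>moves_bound\<close> at \<open>Suc t\<close> keeps the truncated subtraction
    exact.\<close>
  define g where "g t = (?B - moves t Agent1) + (?B - moves t Agent2)" for t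
  have "g (Suc t) \<le> g t" for t by (auto simp: g_def moves_Suc)
  then obtain T where T: "g (Suc t) = g t" if "T \<le> t" for t
    using eventually_constant_nat[of 0 g] by blast
  have still: "\<not> crossing t a" if "T \<le> t" for t a
    using T[OF that, unfolded g_def] moves_bound[of "Suc t" Agent1] moves_bound[of "Suc t" Agent2]
    by (cases a) (auto simp: moves_Suc of_bool_def split: if_splits)
  have tl: "transitions_left (me (Suc t) a) = transitions_left (computed_mem t a)" if "T \<le> t" for t a
    using no_crossing_simps(1,3,4)[OF still[OF that], of a] by (simp only: transitions_left_def)
  define f where "f t = transitions_left (me t Agent1) + transitions_left (me t Agent2)" for t
  \<comment> \<open>Monotone only once moves have ceased: a move in Reverse may push
    \<open>Esteps\<close> past \<open>rightSteps\<close> and raise the value from 1 to 3.\<close>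
  have "f (Suc t) \<le> f t" if "T \<le> t" for t
    using tl[OF that, of Agent1] tl[OF that, of Agent2]
      transitions_left_computed_mem[of t Agent1] transitions_left_computed_mem[of t Agent2]
    unfolding f_def by auto
  then obtain T' where T': "T \<le> T'" "\<forall>t\<ge>T'. f (Suc t) = f t"
    using eventually_constant_nat[of T f] by blast
  have "computed_mem t a = me t a" if "T' \<le> t" for t a
    using T'(2)[rule_format, OF that] tl[of t Agent1] tl[of t Agent2] T'(1) that
      transitions_left_computed_mem[of t Agent1] transitions_left_computed_mem[of t Agent2]
    unfolding f_def by (cases a) auto
  with still T'(1) that show ?thesis by (meson order_trans)
qed

lemma next_activation:
  obtains s where "t \<le> s" "a \<in> active adv s"
  using legal unfolding legal_def by (metis (mono_tags) infinite_nat_iff_unbounded_le mem_Collect_eq)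

section \<open>The phase after the last move and the last transition\<close>

context
  fixes T
  assumes still: "\<And>t a. T \<le> t \<Longrightarrow> \<not> crossing t a"
    and same_memory: "\<And>t a. T \<le> t \<Longrightarrow> computed_mem t a = me t a"
begin

lemma still_control: "T \<le> t \<Longrightarrow> control (me t a) = control (me T a)"
proof (induction t rule: dec_induct)
  case (step t)
  then show ?case using no_crossing_simps(1)[OF still] same_memory by simp
qed simp

lemma still_port:
  assumes "T \<le> t" "t \<le> t'" "pl t a = OnPort p"
  shows "pl t' a = OnPort p" "missing adv t' = Some (edge_at n p)"
proof -
  have S: "pl (Suc s) a = OnPort p \<and> missing adv s = Some (edge_at n p)"
    if s: "T \<le> s" "pl s a = OnPort p" for s
  proof -
    obtain d where d: "p = (nd s a, side_of d)" using on_port[OF s(2)] by blast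
    then have "pl s a = OnPort (nd s a, side_of d)" using s(2) by simp
    note stays = on_port_stay[OF this same_memory[OF s(1)]
        stay_facts(1)[OF same_memory[OF s(1)]] still[OF s(1)]]
    show ?thesis using stays(1) stays(2)[folded d] unfolding s(2) ..
  qed
  show "pl t' a = OnPort p"
    using assms(2) by (induction t' rule: dec_induct) (use S assms in \<open>auto dest: order_trans\<close>)
  with S assms show "missing adv t' = Some (edge_at n p)" by simp
qed

text \<open>At its next activation the agent would find \<open>Btime > 0\<close> and reverse,
  changing its memory.\<close>

lemma still_no_Bounce:
  assumes "T \<le> t" "control (me t a) = Bounce"
  shows "pl t a \<noteq> OnPort p"
proof
  assume p: "pl t a = OnPort p"
  obtain s where s: "t \<le> s" "a \<in> active adv s" by (rule next_activation)
  have "control (me s a) = Bounce"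
    using still_control[of t a] still_control[of s a] assms s(1) by simp
  moreover have "pl s a = OnPort p" using still_port(1)[OF assms(1) s(1) p] .
  moreover have "T \<le> s" using assms(1) s(1) by simp
  ultimately show False
    using stay_facts(3)[OF same_memory s(2)] by auto
qed

text \<open>The port may go to the other agent, which holds it already or is favoured; hence some
  \<open>b\<close> rather than \<open>a\<close>.\<close>

lemma still_port_granted:
  assumes "T \<le> t" "a \<in> active adv t" "explore_dir (control (me t a)) = Some d"
  shows "\<exists>b. pl (Suc t) b = OnPort (nd t a, side_of d)"
proof -
  let ?p = "(nd t a, side_of d)"
  let ?req = "request N lam (active adv t) (R t)"
  have next_place: "pl (Suc t) b = accessed_place t b" for b using no_crossing_simps(7)[OF still[OF assms(1)]] .
  have g: "goal_dir t a = Some d"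
    using stay_facts(1)[OF same_memory[OF assms(1)]] assms by simp
  show ?thesis
  proof (cases "pl t (other a) = OnPort ?p")
    case True
    then have "pl (Suc t) (other a) = OnPort ?p"
      using still_port(1)[of t "Suc t" "other a" ?p] assms(1) by simp
    then show ?thesis by blast
  next
    case False
    show ?thesis
    proof (cases "pl t a \<noteq> OnPort ?p \<and> ?req (other a) = Some ?p \<and> favoured adv t \<noteq> a")
      case True
      then have "favoured adv t = other a" using agent_cases by blast
      with True have "accessed_place t (other a) = OnPort ?p"
        by (simp add: accessed_place_def accessed_def other_other)
      then show ?thesis using next_place[of "other a"] by auto
    next
      case F: False
      with False g have "accessed_place t a = OnPort ?p" by (auto simp: accessed_place_eq)
      then show ?thesis using next_place[of a] by auto
    qed
  qed
qed

lemma still_left_port: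
  assumes "control (me T a) \<noteq> Terminate"
  obtains s where "T \<le> s" "pl s a = OnPort (nd T a, side_of Left)"
proof -
  have nd: "nd t a = nd T a" if "T \<le> t" for t
    using that
  proof (induction t rule: dec_induct)
    case (step t)
    show ?case by (rule trans[OF no_crossing_simps(8)[OF still[OF step(1)]] step(3)])
  qed simp
  obtain t where t: "T \<le> t" "a \<in> active adv t" by (rule next_activation)
  have c: "control (me t a) = control (me T a)" using t(1) by (rule still_control)
  have "\<exists>d. explore_dir (control (me t a)) = Some d"
    unfolding c using assms by (cases "control (me T a)") simp_all
  then obtain d where d: "explore_dir (control (me t a)) = Some d" ..
  obtain b where b: "pl (Suc t) b = OnPort (nd T a, side_of d)"
    using still_port_granted[OF t d] unfolding nd[OF t(1)] by blast
  \<comment> \<open>The occupant of a right port would be in Bounce, which is excluded.\<close>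
  have "d = Left"
  proof (rule ccontr)
    assume "d \<noteq> Left"
    then have "d = Right" by (cases d) auto
    then have "control (me (Suc t) b) = Bounce"
      using on_port[OF b] side_of_inj by (auto simp: Bounce_iff)
    with still_no_Bounce[OF le_SucI[OF t(1)]] b show False by blast
  qed
  show ?thesis
  proof (cases "b = a")
    case True
    with b \<open>d = Left\<close> t(1) show ?thesis by (intro that[of "Suc t"]) simp_all
  next
    case False
    then have "b = other a" using agent_cases by blast
    \<comment> \<open>The other agent never leaves this left port, so at its next activation
      \<open>a\<close> would either catch it or share the port with it; both are impossible.\<close>
    obtain s where s: "Suc t \<le> s" "a \<in> active adv s" by (rule next_activation)
    have Ts: "T \<le> s" using t(1) s(1) by simp
    have o: "pl s (other a) = OnPort (nd s a, side_of Left)"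
      using still_port(1)[of "Suc t" s b] b \<open>b = other a\<close> \<open>d = Left\<close> t(1) s(1) nd[OF Ts] by simp
    have e: "explore_dir (control (me s a)) = Some Left"
      using still_control[OF Ts] c d \<open>d = Left\<close> by simp
    then have "\<not> (\<exists>v. pl s a = InNode v)"
      using stay_facts(2)[OF same_memory[OF Ts] s(2)] o by (simp add: left_moving_iff)
    then obtain p where p: "pl s a = OnPort p" by (cases "pl s a") auto
    with e on_port[OF p] have "pl s a = OnPort (nd s a, side_of Left)" by auto
    with not_same_port o show ?thesis by blast
  qed
qed

lemma still_waits:
  assumes "control (me T a) \<noteq> Terminate"
  shows "waits_perpetually R a"
proof -
  obtain s where "T \<le> s" "pl s a = OnPort (nd T a, side_of Left)"
    using still_left_port[OF assms] .
  then show ?thesis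
    unfolding waits_perpetually_def using still_port(1) by blast
qed

text \<open>Otherwise both agents end up on left ports for good, held by a single missing edge;
  their ports then coincide, against mutual exclusion.\<close>

lemma still_some_Terminate:
  obtains a where "control (me T a) = Terminate"
proof (cases "\<exists>a. control (me T a) = Terminate")
  case False
  obtain s1 where s1: "T \<le> s1" "pl s1 Agent1 = OnPort (nd T Agent1, side_of Left)"
    using still_left_port[of Agent1] False by blast
  obtain s2 where s2: "T \<le> s2" "pl s2 Agent2 = OnPort (nd T Agent2, side_of Left)"
    using still_left_port[of Agent2] False by blast
  note p1 = still_port[OF s1(1) max.cobounded1 s1(2), of s2]
    and p2 = still_port[OF s2(1) max.cobounded2 s2(2), of s1]
  have "edge_at n (nd T Agent1, side_of Left) = edge_at n (nd T Agent2, side_of Left)"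
    using p1(2) p2(2) by (metis option.inject)
  then have "nd T Agent1 = nd T Agent2"
    by (rule edge_at_same[OF nd_less nd_less])
  with p2(1) have "pl (max s1 s2) (other Agent1) = OnPort (nd T Agent1, side_of Left)"
    by (metis other.simps(1))
  with not_same_port[OF p1(1)] show ?thesis by blast
qed (use that in blast)

end

section \<open>Final outcome and cost bound\<close>

lemma outcome:
  "\<exists>a. explicitly_terminates n R a \<and>
    (\<forall>b. b \<noteq> a \<longrightarrow> explicitly_terminates n R b \<or> waits_perpetually R b)"
proof -
  obtain T where T: "\<And>t a. T \<le> t \<Longrightarrow> \<not> crossing t a" "\<And>t a. T \<le> t \<Longrightarrow> computed_mem t a = me t a"
    by (rule eventually_still) blast
  obtain a where "control (me T a) = Terminate"
    using still_some_Terminate[OF T] by blast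
  moreover have "explicitly_terminates n R b \<or> waits_perpetually R b" for b
    using explicitly_terminates still_waits[OF T] by blast
  ultimately show ?thesis
    using explicitly_terminates by blast
qed

lemma traversals_bound: "real (traversals n N lam start adv T) \<le> 8 * real N ^ 2"
proof -
  have "traversals n N lam start adv T \<le> 2 * (2 * N * N + 2 * N)"
    using moves_bound[of T Agent1] moves_bound[of T Agent2] by (simp add: traversals_eq)
  \<comment> \<open>Uses \<open>N \<le> N ^ 2\<close>, so that each agent contributes at most
    \<open>4 * N ^ 2\<close>.\<close>
  also have "\<dots> \<le> 8 * N ^ 2"
    by (simp add: power2_eq_square)
  finally show ?thesis
    using of_nat_mono by fastforce
qed

end

theorem theorem12:
  shows "\<exists>f :: nat \<Rightarrow> real. f \<in> O(\<lambda>N. real N ^ 2) \<and>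
    (\<forall>n N lam start adv.
       2 \<le> n \<and> n \<le> N \<and> (\<forall>a. consistent n (lam a)) \<and> chirality n lam \<and>
       (\<forall>a. start a < n) \<and> legal n adv \<longrightarrow>
       (let R = run n N lam start adv in
          (\<exists>t. explored_by n R t) \<and>
          (\<forall>T. real (traversals n N lam start adv T) \<le> f N) \<and>
          (\<exists>a. explicitly_terminates n R a \<and>
               (\<forall>b. b \<noteq> a \<longrightarrow> explicitly_terminates n R b \<or> waits_perpetually R b))))"
proof (intro exI[of _ "\<lambda>N. 8 * real N ^ 2"] conjI allI impI)
  show "(\<lambda>N. 8 * real N ^ 2) \<in> O(\<lambda>N. real N ^ 2)" by simp
next
  fix n N :: nat and lam :: "agent \<Rightarrow> orientation" and start :: "agent \<Rightarrow> nat" and adv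
  assume "2 \<le> n \<and> n \<le> N \<and> (\<forall>a. consistent n (lam a)) \<and> chirality n lam \<and>
       (\<forall>a. start a < n) \<and> legal n adv"
  then interpret chiral_run n N lam start adv by unfold_locales auto
  \<comment> \<open>Explicit termination of one agent includes that the ring was explored
    before.\<close>
  have "\<exists>t. explored_by n (run n N lam start adv) t"
    using outcome unfolding explicitly_terminates_def by blast
  with traversals_bound outcome
  show "let R = run n N lam start adv in
          (\<exists>t. explored_by n R t) \<and>
          (\<forall>T. real (traversals n N lam start adv T) \<le> 8 * real N ^ 2) \<and>
          (\<exists>a. explicitly_terminates n R a \<and>
               (\<forall>b. b \<noteq> a \<longrightarrow> explicitly_terminates n R b \<or> waits_perpetually R b))"
    unfolding Let_def by blast
qed

end
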